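(* Let $G$ be a countable group, and let $X$ be a proper $\mathrm{CAT}(0)$ metric space equipped with an isometric $G$-action. Assume that the $G$-action on $X$ is nonelementary and that $G$ contains an element acting on $X$ as a rank one isometry. Then the $G$-action on $X$ is properly proximal. In particular, if the $G$-action on $X$ is proper, then $G$ is properly proximal.
   Context: $\partial_\infty X$ denotes the visual boundary of $X$. An isometric action of a group $G$ on a $\mathrm{CAT}(0)$ space $X$ is nonelementary if $G$ fixes no point of $X$ and has no finite orbit in $\partial_\infty X$. An isometry $g$ of $X$ is rank one if it has a $g$-invariant axis in $X$ which does not bound a (flat) half-plane. A sequence $(g_n)_{n\in\mathbb N}$ in $G$ escapes every compact subspace of $X$ if for some (equivalently any) $x\in X$, the sequence $(g_nx)_{n}$ eventually leaves every compact subset of $X$. Properly proximal action: the isometric $G$-action on the proper metric space $X$ is properly proximal if there exist finitely many compact metrizable $G$-spaces $K_1,\dots,K_\ell$ (compact metrizable spaces with actions by homeomorphisms), none of which carries a $G$-invariant probability measure, and for each $i$ a diffuse (atomless) Borel probability measure $\eta_i$ on $K_i$, such that for every sequence $(g_n)$ in $G$ escaping every compact subspace of $X$, there exist $i\in\{1,\dots,\ell\}$ and a subsequence $(g_{\sigma(n)})$ such that for every $h\in G$, $g_{\sigma(n)}h\eta_i-g_{\sigma(n)}\eta_i\to 0$ in the weak-$*$ topology. Properly proximal group: a countable group $G$ is properly proximal if there exist finitely many compact $G$-spaces $K_1,\dots,K_\ell$ and diffuse probability measures $\eta_i$ on $K_i$ such that (1) no $K_i$ carries a $G$-invariant probability measure,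 and (2) for every nonprincipal ultrafilter $\omega$ on $G$ there exists $i$ such that for every $h\in G$, $\lim_{g\to\omega}((gh)\eta_i-g\eta_i)=0$ in the weak-$*$ topology. *)

theory Defs
  imports "HOL-Probability.Probability" "HOL-Algebra.Group_Action"
begin

definition geodesic_path :: "(real \<Rightarrow> 'x::metric_space) \<Rightarrow> 'x \<Rightarrow> 'x \<Rightarrow> bool" where
  "geodesic_path c a b \<longleftrightarrow> c 0 = a \<and> c (dist a b) = b \<and>
     (\<forall>s\<in>{0..dist a b}. \<forall>t\<in>{0..dist a b}. dist (c s) (c t) = \<bar>s - t\<bar>)"

definition geodesic_space :: "'x::metric_space itself \<Rightarrow> bool" where
  "geodesic_space T \<longleftrightarrow> (\<forall>a b :: 'x. \<exists>c. geodesic_path c a b)"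

text \<open>Comparison point (in the Euclidean plane, modelled by complex) of the point at
  parameter s on the side from a to b of length l, the comparison side being from ab to bb.\<close>
definition comparison_point :: "complex \<Rightarrow> complex \<Rightarrow> real \<Rightarrow> real \<Rightarrow> complex" where
  "comparison_point ab bb l s = ab + (s / l) *\<^sub>R (bb - ab)"

text \<open>CAT(0) space (Bridson--Haefliger II.1.1): geodesic, and every geodesic triangle
  satisfies the CAT(0) inequality with respect to its Euclidean comparison triangle.\<close>
definition CAT0_space :: "'x::metric_space itself \<Rightarrow> bool" where
  "CAT0_space T \<longleftrightarrow> geodesic_space T \<and>
    (\<forall>(x::'x) y z cxy cyz czx (xb::complex) yb zb.
       geodesic_path cxy x y \<and> geodesic_path cyz y z \<and> geodesic_path czx z x \<and>
       dist xb yb = dist x y \<and> dist yb zb = dist y z \<and> dist zb xb = dist z x \<longrightarrow>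
       (let S = {(cxy, x, y, xb, yb), (cyz, y, z, yb, zb), (czx, z, x, zb, xb)} in
        \<forall>(c, a, b, ab, bb)\<in>S. \<forall>(c', a', b', ab', bb')\<in>S.
          \<forall>s\<in>{0..dist a b}. \<forall>t\<in>{0..dist a' b'}.
            dist (c s) (c' t) \<le>
              dist (comparison_point ab bb (dist a b) s) (comparison_point ab' bb' (dist a' b') t)))"

definition proper_metric_space :: "'x::metric_space itself \<Rightarrow> bool" where
  "proper_metric_space T \<longleftrightarrow> (\<forall>(x::'x) r. compact (cball x r))"

definition geodesic_ray :: "(real \<Rightarrow> 'x::metric_space) \<Rightarrow> bool" where
  "geodesic_ray r \<longleftrightarrow> (\<forall>s\<ge>0. \<forall>t\<ge>0. dist (r s) (r t) = \<bar>s - t\<bar>)"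

definition geodesic_line :: "(real \<Rightarrow> 'x::metric_space) \<Rightarrow> bool" where
  "geodesic_line l \<longleftrightarrow> (\<forall>s t. dist (l s) (l t) = \<bar>s - t\<bar>)"

definition asymptotic_rays :: "(real \<Rightarrow> 'x::metric_space) \<Rightarrow> (real \<Rightarrow> 'x) \<Rightarrow> bool" where
  "asymptotic_rays r r' \<longleftrightarrow> (\<exists>B. \<forall>t\<ge>0. dist (r t) (r' t) \<le> B)"

definition boundary_point :: "(real \<Rightarrow> 'x::metric_space) \<Rightarrow> (real \<Rightarrow> 'x) set" where
  "boundary_point r = {r'. geodesic_ray r' \<and> asymptotic_rays r r'}"

definition visual_boundary :: "'x::metric_space itself \<Rightarrow> (real \<Rightarrow> 'x) set set" where
  "visual_boundary T = {boundary_point r | r :: real \<Rightarrow> 'x. geodesic_ray r}"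

definition bounds_flat_half_plane :: "(real \<Rightarrow> 'x::metric_space) \<Rightarrow> bool" where
  "bounds_flat_half_plane l \<longleftrightarrow>
     (\<exists>F :: complex \<Rightarrow> 'x.
        (\<forall>z w. Im z \<ge> 0 \<longrightarrow> Im w \<ge> 0 \<longrightarrow> dist (F z) (F w) = cmod (z - w)) \<and>
        F ` {z. Im z = 0} = range l)"

definition isometry_of :: "('x::metric_space \<Rightarrow> 'x) \<Rightarrow> bool" where
  "isometry_of f \<longleftrightarrow> (\<forall>x y. dist (f x) (f y) = dist x y)"

definition rank_one_isometry :: "('x::metric_space \<Rightarrow> 'x) \<Rightarrow> bool" where
  "rank_one_isometry f \<longleftrightarrow> isometry_of f \<and>
     (\<exists>l a. geodesic_line l \<and> a > 0 \<and> (\<forall>t. f (l t) = l (t + a)) \<and> \<not> bounds_flat_half_plane l)"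

definition isometric_action :: "('g, 'b) monoid_scheme \<Rightarrow> ('g \<Rightarrow> 'x::metric_space \<Rightarrow> 'x) \<Rightarrow> bool" where
  "isometric_action G \<phi> \<longleftrightarrow> group_action G (UNIV :: 'x set) \<phi> \<and> (\<forall>g\<in>carrier G. isometry_of (\<phi> g))"

definition nonelementary_action :: "('g, 'b) monoid_scheme \<Rightarrow> ('g \<Rightarrow> 'x::metric_space \<Rightarrow> 'x) \<Rightarrow> bool" where
  "nonelementary_action G \<phi> \<longleftrightarrow>
     (\<forall>x. \<exists>g\<in>carrier G. \<phi> g x \<noteq> x) \<and>
     (\<forall>r. geodesic_ray r \<longrightarrow> infinite ((\<lambda>g. boundary_point (\<phi> g \<circ> r)) ` carrier G))"

definition proper_action :: "('g, 'b) monoid_scheme \<Rightarrow> ('g \<Rightarrow> 'x::metric_space \<Rightarrow> 'x) \<Rightarrow> bool" where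
  "proper_action G \<phi> \<longleftrightarrow> (\<forall>C. compact C \<longrightarrow> finite {g\<in>carrier G. \<phi> g ` C \<inter> C \<noteq> {}})"

definition escapes_compacta :: "('g \<Rightarrow> 'x::metric_space \<Rightarrow> 'x) \<Rightarrow> (nat \<Rightarrow> 'g) \<Rightarrow> bool" where
  "escapes_compacta \<phi> gs \<longleftrightarrow>
     (\<exists>x. \<forall>C. compact C \<longrightarrow> (\<forall>\<^sub>F n in sequentially. \<phi> (gs n) x \<notin> C))"

definition borel_on :: "'k topology \<Rightarrow> 'k measure" where
  "borel_on K = sigma (topspace K) {U. openin K U}"

definition borel_probability :: "'k topology \<Rightarrow> 'k measure \<Rightarrow> bool" where
  "borel_probability K \<mu> \<longleftrightarrow> prob_space \<mu> \<and> space \<mu> = topspace K \<and> sets \<mu> = sets (borel_on K)"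

definition diffuse :: "'k topology \<Rightarrow> 'k measure \<Rightarrow> bool" where
  "diffuse K \<mu> \<longleftrightarrow> (\<forall>x\<in>topspace K. emeasure \<mu> {x} = 0)"

definition push :: "'k topology \<Rightarrow> ('g \<Rightarrow> 'k \<Rightarrow> 'k) \<Rightarrow> 'g \<Rightarrow> 'k measure \<Rightarrow> 'k measure" where
  "push K \<alpha> g \<mu> = distr \<mu> (borel_on K) (\<alpha> g)"

definition G_space :: "('g, 'b) monoid_scheme \<Rightarrow> 'k topology \<Rightarrow> ('g \<Rightarrow> 'k \<Rightarrow> 'k) \<Rightarrow> bool" where
  "G_space G K \<alpha> \<longleftrightarrow> group_action G (topspace K) \<alpha> \<and> (\<forall>g\<in>carrier G. homeomorphic_map K K (\<alpha> g))"

definition has_invariant_probability :: "('g, 'b) monoid_scheme \<Rightarrow> 'k topology \<Rightarrow> ('g \<Rightarrow> 'k \<Rightarrow> 'k) \<Rightarrow> bool" where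
  "has_invariant_probability G K \<alpha> \<longleftrightarrow>
     (\<exists>\<mu>. borel_probability K \<mu> \<and> (\<forall>g\<in>carrier G. push K \<alpha> g \<mu> = \<mu>))"

definition weak_star_diff_to_zero :: "'k topology \<Rightarrow> ('i \<Rightarrow> 'k measure) \<Rightarrow> ('i \<Rightarrow> 'k measure) \<Rightarrow> 'i filter \<Rightarrow> bool" where
  "weak_star_diff_to_zero K \<mu> \<nu> F \<longleftrightarrow>
     (\<forall>f. continuous_map K euclideanreal f \<longrightarrow>
        ((\<lambda>n. integral\<^sup>L (\<mu> n) f - integral\<^sup>L (\<nu> n) f) \<longlongrightarrow> 0) F)"

text \<open>Compact metrizable spaces are realised with carrier a subset of real (every compact
  metrizable space has cardinality at most the continuum).\<close>
definition properly_proximal_action :: "('g, 'b) monoid_scheme \<Rightarrow> ('g \<Rightarrow> 'x::metric_space \<Rightarrow> 'x) \<Rightarrow> bool" where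
  "properly_proximal_action G \<phi> \<longleftrightarrow>
     (\<exists>(m::nat) (K :: nat \<Rightarrow> real topology) \<alpha> \<eta>.
        (\<forall>i<m. compact_space (K i) \<and> metrizable_space (K i) \<and> G_space G (K i) (\<alpha> i) \<and>
               \<not> has_invariant_probability G (K i) (\<alpha> i) \<and>
               borel_probability (K i) (\<eta> i) \<and> diffuse (K i) (\<eta> i)) \<and>
        (\<forall>gs. (\<forall>n. gs n \<in> carrier G) \<and> escapes_compacta \<phi> gs \<longrightarrow>
           (\<exists>i<m. \<exists>\<sigma>. strict_mono \<sigma> \<and>
              (\<forall>h\<in>carrier G. weak_star_diff_to_zero (K i)
                  (\<lambda>n. push (K i) (\<alpha> i) (gs (\<sigma> n) \<otimes>\<^bsub>G\<^esub> h) (\<eta> i))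
                  (\<lambda>n. push (K i) (\<alpha> i) (gs (\<sigma> n)) (\<eta> i)) sequentially))))"

definition nonprincipal_ultrafilter_on :: "'a set \<Rightarrow> 'a filter \<Rightarrow> bool" where
  "nonprincipal_ultrafilter_on A \<omega> \<longleftrightarrow>
     \<omega> \<noteq> bot \<and> (\<forall>\<^sub>F x in \<omega>. x \<in> A) \<and>
     (\<forall>P. eventually P \<omega> \<or> eventually (\<lambda>x. \<not> P x) \<omega>) \<and>
     (\<forall>a. \<not> (\<forall>\<^sub>F x in \<omega>. x = a))"

definition properly_proximal_group :: "('g, 'b) monoid_scheme \<Rightarrow> bool" where
  "properly_proximal_group G \<longleftrightarrow>
     (\<exists>(m::nat) (K :: nat \<Rightarrow> real topology) \<alpha> \<eta>.
        (\<forall>i<m. compact_space (K i) \<and> Hausdorff_space (K i) \<and> G_space G (K i) (\<alpha> i) \<and>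
               \<not> has_invariant_probability G (K i) (\<alpha> i) \<and>
               borel_probability (K i) (\<eta> i) \<and> diffuse (K i) (\<eta> i)) \<and>
        (\<forall>\<omega>. nonprincipal_ultrafilter_on (carrier G) \<omega> \<longrightarrow>
           (\<exists>i<m. \<forall>h\<in>carrier G. weak_star_diff_to_zero (K i)
                  (\<lambda>g. push (K i) (\<alpha> i) (g \<otimes>\<^bsub>G\<^esub> h) (\<eta> i))
                  (\<lambda>g. push (K i) (\<alpha> i) g (\<eta> i)) \<omega>)))"

end

theory Submission
  imports Defs
begin

text \<open>A single compact space suffices: \<open>K\<close> is the product of the horofunction compactification of \<open>X\<close>
  with the unit interval (on which \<open>G\<close> acts trivially), and \<open>\<eta>\<close> is the product of the Dirac mass at a
  base point \<open>x0\<close> of \<open>X\<close> and Lebesgue measure; the interval factor only serves to make \<open>\<eta>\<close> diffuse.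
  If \<open>g\<close> escapes, then \<open>g h x0\<close> and \<open>g x0\<close> stay at bounded distance from each other and leave every
  compact set, so by the quadrilateral inequality their horofunctions become arbitrarily close, which
  gives the asymptotic invariance.

  For the absence of an invariant probability measure, let \<open>l\<close> be an axis of the rank one element \<open>k\<close>,
  of translation length \<open>a\<close>. For horofunctions \<open>b\<close> the continuous functions
  \<open>F n b = b (l (n a)) - b (l ((n + 1) a))\<close> satisfy \<open>F n (k b) = F (n - 1) b \<ge> F n b\<close> by convexity,
  hence for an invariant measure almost every \<open>b\<close> is affine along \<open>l\<close>. A slope in the open interval
  from \<open>-1\<close> to \<open>1\<close> would produce a flat half-plane, spanned by the gradient rays of \<open>b\<close> issuing from
  \<open>l\<close>. If the slope is \<open>1\<close> or \<open>-1\<close> almost surely, then two geodesic rays along which the same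
  horofunction decreases with unit speed being asymptotic, the orbit of an endpoint of \<open>l\<close> consists of
  endpoints of \<open>l\<close>, which contradicts nonelementarity.\<close>

section \<open>Comparison inequalities\<close>

lemma CAT0_geodesic:
  fixes a b :: "'x::metric_space"
  assumes "CAT0_space TYPE('x)"
  obtains c where "geodesic_path c a b"
  using assms unfolding CAT0_space_def geodesic_space_def by metis

text \<open>By Stewart's formula the right-hand side is the squared distance, in the comparison
  triangle, from the vertex of \<open>p\<close> to the point at fraction \<open>u\<close> of the
  opposite side. All later comparison arguments go through this inequality.\<close>

lemma CAT0_stewart:
  fixes c :: "real \<Rightarrow> 'x::metric_space"
  assumes "CAT0_space TYPE('x)" and c: "geodesic_path c y z" and u: "0 \<le> u" "u \<le> 1"
  shows "(dist p (c (u * dist y z)))\<^sup>2 \<le>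
    (1 - u) * (dist p y)\<^sup>2 + u * (dist p z)\<^sup>2 - u * (1 - u) * (dist y z)\<^sup>2"
proof (cases "y = z")
  case True
  then show ?thesis using c by (simp add: geodesic_path_def algebra_simps)
next
  case False
  define D A B where "D = dist y z" and "A = dist p y" and "B = dist p z"
  have D: "D > 0" using False by (simp add: D_def)
  have tri: "A \<le> B + D" "B \<le> A + D" "D \<le> A + B" "A \<ge> 0" "B \<ge> 0"
    using dist_triangle[of p y z] dist_triangle[of p z y] dist_triangle[of y z p]
    by (simp_all add: A_def B_def D_def dist_commute)
  \<comment> \<open>With \<open>y\<close> placed at 0 and \<open>z\<close> at \<open>D\<close> on
    the real axis, the law of cosines forces \<open>v\<close> to be the real part of the vertex for
    \<open>p\<close>. The triangle inequalities give \<open>v\<^sup>2 \<le> A\<^sup>2\<close>, so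
    the height \<open>w\<close> is real.\<close>
  define v where "v = (A\<^sup>2 + D\<^sup>2 - B\<^sup>2) / (2 * D)"
  have vD: "2 * D * v = A\<^sup>2 + D\<^sup>2 - B\<^sup>2" using D by (simp add: v_def)
  have "(A - D)\<^sup>2 \<le> B\<^sup>2" using tri D by (intro abs_le_square_iff[THEN iffD1]) auto
  then have "2 * D * v \<le> 2 * D * A" unfolding vD by (simp add: power2_eq_square algebra_simps)
  then have "v \<le> A" using D by simp
  have "B\<^sup>2 \<le> (A + D)\<^sup>2" using tri D by (intro abs_le_square_iff[THEN iffD1]) auto
  then have "2 * D * (- A) \<le> 2 * D * v" unfolding vD by (simp add: power2_eq_square algebra_simps)
  then have "- A \<le> v" using D by (simp only: mult_le_cancel_left_pos[of "2 * D"] mult_pos_pos zero_less_numeral)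
  then have vA: "v\<^sup>2 \<le> A\<^sup>2" using \<open>v \<le> A\<close> by (intro abs_le_square_iff[THEN iffD1]) auto
  define w where "w = sqrt (A\<^sup>2 - v\<^sup>2)"
  have w: "w\<^sup>2 = A\<^sup>2 - v\<^sup>2" using vA by (simp add: w_def)
  define pb where "pb = Complex v w"
  have cm: "(dist a b)\<^sup>2 = (Re a - Re b)\<^sup>2 + (Im a - Im b)\<^sup>2" for a b :: complex
    by (simp add: dist_norm cmod_power2)
  have "(dist pb 0)\<^sup>2 = A\<^sup>2" by (subst cm) (simp add: pb_def w)
  then have dA: "dist pb 0 = A" using tri by (simp only: power2_eq_iff_nonneg zero_le_dist)
  have "(dist (complex_of_real D) pb)\<^sup>2 = B\<^sup>2"
    using vD by (subst cm) (simp add: pb_def w power2_diff)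
  then have dB: "dist (complex_of_real D) pb = B" using tri by (simp only: power2_eq_iff_nonneg zero_le_dist)
  obtain cpy where cpy: "geodesic_path cpy p y" by (rule CAT0_geodesic[OF assms(1)])
  obtain czp where czp: "geodesic_path czp z p" by (rule CAT0_geodesic[OF assms(1)])
  let ?S = "{(cpy, p, y, pb, 0), (c, y, z, 0, complex_of_real D), (czp, z, p, complex_of_real D, pb)}"
  have all: "\<forall>(c, a, b, ab, bb)\<in>?S. \<forall>(c', a', b', ab', bb')\<in>?S.
          \<forall>s\<in>{0..dist a b}. \<forall>t\<in>{0..dist a' b'}.
            dist (c s) (c' t) \<le>
              dist (comparison_point ab bb (dist a b) s) (comparison_point ab' bb' (dist a' b') t)"
  proof (rule mp[OF conjunct2[OF assms(1)[unfolded CAT0_space_def Let_def], THEN spec[of _ p], THEN spec[of _ y],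
        THEN spec[of _ z], THEN spec[of _ cpy], THEN spec[of _ c], THEN spec[of _ czp],
        THEN spec[of _ pb], THEN spec[of _ 0], THEN spec[of _ "complex_of_real D"]]], intro conjI)
    show "dist pb 0 = dist p y" using dA by (simp only: A_def)
    show "dist 0 (complex_of_real D) = dist y z" using D by (simp add: D_def)
    show "dist (complex_of_real D) pb = dist z p" using dB by (simp only: B_def dist_commute)
  qed (fact cpy c czp)+
  have "\<forall>s\<in>{0..dist p y}. \<forall>t\<in>{0..dist y z}. dist (cpy s) (c t) \<le>
      dist (comparison_point pb 0 (dist p y) s) (comparison_point 0 (complex_of_real D) (dist y z) t)"
    using bspec[OF bspec[OF all insertI1, unfolded prod.case] insertI2[OF insertI1], unfolded prod.case] .
  moreover have "0 \<in> {0..dist p y}" "u * D \<in> {0..dist y z}"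
    using u D by (auto simp: D_def[symmetric] mult_left_le_one_le)
  ultimately have "dist (cpy 0) (c (u * D)) \<le> dist (comparison_point pb 0 (dist p y) 0)
     (comparison_point 0 (complex_of_real D) (dist y z) (u * D))" by blast
  also have "\<dots> = dist pb (u * D)"
    using D by (simp add: comparison_point_def D_def scaleR_conv_of_real)
  finally have "(dist p (c (u * D)))\<^sup>2 \<le> (dist pb (u * D))\<^sup>2"
    using cpy by (intro power_mono) (simp_all only: geodesic_path_def zero_le_dist)
  also have "\<dots> = A\<^sup>2 - 2 * D * v * u + (u * D)\<^sup>2"
    using w by (subst cm) (simp add: pb_def power2_eq_square algebra_simps)
  also have "\<dots> = (1 - u) * A\<^sup>2 + u * B\<^sup>2 - u * (1 - u) * D\<^sup>2"
    unfolding vD by (simp add: power2_eq_square algebra_simps)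
  finally show ?thesis by (simp add: A_def B_def D_def)
qed

text \<open>The diagonal from \<open>q\<close> to \<open>x0\<close> is estimated by passing through
  the midpoint \<open>m\<close> of the other diagonal; Stewart's inequality controls both
  halves.\<close>

lemma CAT0_quadrilateral:
  fixes p q y x0 :: "'x::metric_space"
  assumes "CAT0_space TYPE('x)"
  shows "(dist p y)\<^sup>2 + (dist q x0)\<^sup>2 \<le> (dist p q)\<^sup>2 + (dist q y)\<^sup>2 + (dist y x0)\<^sup>2 + (dist x0 p)\<^sup>2"
proof -
  obtain c where c: "geodesic_path c p y" by (rule CAT0_geodesic[OF assms])
  define m where "m = c (1/2 * dist p y)"
  have 1: "(dist q m)\<^sup>2 \<le> (dist q p)\<^sup>2 / 2 + (dist q y)\<^sup>2 / 2 - (dist p y)\<^sup>2 / 4"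
    using CAT0_stewart[OF assms c, of "1/2" q] by (simp add: m_def)
  have 2: "(dist x0 m)\<^sup>2 \<le> (dist x0 p)\<^sup>2 / 2 + (dist x0 y)\<^sup>2 / 2 - (dist p y)\<^sup>2 / 4"
    using CAT0_stewart[OF assms c, of "1/2" x0] by (simp add: m_def)
  have "(dist q x0)\<^sup>2 \<le> (dist q m + dist x0 m)\<^sup>2"
    by (intro power_mono dist_triangle2) auto
  also have "\<dots> \<le> 2 * (dist q m)\<^sup>2 + 2 * (dist x0 m)\<^sup>2"
    using zero_le_power2[of "dist q m - dist x0 m"] by (simp add: power2_eq_square algebra_simps)
  finally show ?thesis using 1 2 by (simp add: dist_commute)
qed

lemma geodesic_line_stewart:
  fixes l :: "real \<Rightarrow> 'x::metric_space"
  assumes X: "CAT0_space TYPE('x)" and l: "geodesic_line l" and st: "s < t" and u: "0 \<le> u" "u \<le> 1"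
  shows "(dist p (l ((1 - u) * s + u * t)))\<^sup>2 \<le>
    (1 - u) * (dist p (l s))\<^sup>2 + u * (dist p (l t))\<^sup>2 - u * (1 - u) * (t - s)\<^sup>2"
proof -
  have d: "dist (l s) (l t) = t - s" using l st by (simp add: geodesic_line_def)
  have "geodesic_path (\<lambda>r. l (s + r)) (l s) (l t)"
    unfolding geodesic_path_def d using l[unfolded geodesic_line_def] by simp
  from CAT0_stewart[OF X this u, of p]
  show ?thesis by (simp add: d algebra_simps)
qed

text \<open>The distances \<open>A\<close> and \<open>B\<close> to the endpoints differ by at most
  \<open>t - s\<close>, so the correction term in Stewart's inequality is at least
  \<open>u * (1 - u) * (A - B)\<^sup>2\<close>. Subtracting the latter turns the interpolated
  squares into the square of the interpolation.\<close>

lemma convex_on_dist_geodesic_line: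
  fixes l :: "real \<Rightarrow> 'x::metric_space"
  assumes X: "CAT0_space TYPE('x)" and l: "geodesic_line l"
  shows "convex_on UNIV (\<lambda>t. dist p (l t))"
proof (rule convex_on_linorderI)
  fix u s t :: real assume u: "0 < u" "u < 1" and st: "s < t"
  let ?A = "dist p (l s)" and ?B = "dist p (l t)"
  have "dist (l s) (l t) = t - s" using l st by (simp add: geodesic_line_def)
  then have "\<bar>?A - ?B\<bar> \<le> t - s"
    using dist_triangle[of p "l s" "l t"] dist_triangle[of p "l t" "l s"] by (simp add: dist_commute)
  then have "(?A - ?B)\<^sup>2 \<le> (t - s)\<^sup>2"
    using st by (intro abs_le_square_iff[THEN iffD1]) simp
  then have *: "u * (1 - u) * (?A - ?B)\<^sup>2 \<le> u * (1 - u) * (t - s)\<^sup>2"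
    using u by (intro mult_left_mono) auto
  have "(dist p (l ((1 - u) * s + u * t)))\<^sup>2 \<le> ((1 - u) * ?A + u * ?B)\<^sup>2"
    using geodesic_line_stewart[OF X l st, of u p] u *
    by (simp add: power2_eq_square algebra_simps)
  then show "dist p (l ((1 - u) *\<^sub>R s + u *\<^sub>R t)) \<le> (1 - u) * ?A + u * ?B"
    unfolding real_scaleR_def by (rule power2_le_imp_le) (use u in simp)
qed auto

text \<open>Subtracting the square of the parameter absorbs the correction term of Stewart's
  inequality exactly, since that term is the convexity defect of the square function.\<close>

lemma convex_on_dist_square_geodesic_line:
  fixes l :: "real \<Rightarrow> 'x::metric_space"
  assumes X: "CAT0_space TYPE('x)" and l: "geodesic_line l"
  shows "convex_on UNIV (\<lambda>t. (dist p (l t))\<^sup>2 - t\<^sup>2)"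
proof (rule convex_on_linorderI)
  fix u s t :: real assume u: "0 < u" "u < 1" and st: "s < t"
  show "(dist p (l ((1 - u) *\<^sub>R s + u *\<^sub>R t)))\<^sup>2 - ((1 - u) *\<^sub>R s + u *\<^sub>R t)\<^sup>2
      \<le> (1 - u) * ((dist p (l s))\<^sup>2 - s\<^sup>2) + u * ((dist p (l t))\<^sup>2 - t\<^sup>2)"
    using geodesic_line_stewart[OF X l st, of u p] u
    by (simp add: power2_eq_square algebra_simps)
qed auto

lemma convex_on_bounded_above_const:
  fixes h :: "real \<Rightarrow> real"
  assumes h: "convex_on UNIV h" and M: "\<And>t. h t \<le> M"
  shows "h s = h t"
proof -
  have le: "h x \<le> h y" for x y
  proof (rule field_le_epsilon)
    fix e :: real assume e: "e > 0"
    \<comment> \<open>The point \<open>x\<close> lies at fraction \<open>1/K\<close> of the way from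
      \<open>y\<close> to \<open>z\<close>, and \<open>K\<close> is so large that the bound
      \<open>M\<close> at \<open>z\<close> contributes an excess of at most
      \<open>e\<close>.\<close>
    define K where "K = max 1 ((M - h y) / e)"
    have K: "K \<ge> 1" "(M - h y) / e \<le> K" by (auto simp: K_def)
    then have Ke: "M - h y \<le> e * K" using e by (simp add: field_simps)
    define z where "z = y + K * (x - y)"
    have "x = (1 - 1/K) *\<^sub>R y + (1/K) *\<^sub>R z"
      using K by (simp add: z_def field_simps)
    then have "h x \<le> (1 - 1/K) * h y + (1/K) * h z"
      using convex_onD[OF h, of "1/K" y z] K by simp
    also have "\<dots> \<le> (1 - 1/K) * h y + (1/K) * (e * K + h y)"
      using K Ke M[of z] by (intro add_left_mono mult_left_mono) auto
    also have "\<dots> = h y + e" using K by (simp add: field_simps)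
    finally show "h x \<le> h y + e" .
  qed
  from le[of s t] le[of t s] show ?thesis by simp
qed

section \<open>Horofunctions\<close>

text \<open>The sequence \<open>z\<close> may stay bounded, so normalised distance functions of
  points are included and the set of all such limits is compact. Escape of \<open>z\<close> to
  infinity is assumed separately where directions matter.\<close>

definition horofunction :: "'x::metric_space \<Rightarrow> (nat \<Rightarrow> 'x) \<Rightarrow> ('x \<Rightarrow> real) \<Rightarrow> bool" where
  "horofunction x0 z b \<longleftrightarrow> (\<forall>y. (\<lambda>n. dist (z n) y - dist (z n) x0) \<longlonglongrightarrow> b y)"

lemma horofunction_tendsto:
  "horofunction x0 z b \<Longrightarrow> (\<lambda>n. dist (z n) y - dist (z n) x0) \<longlonglongrightarrow> b y"
  by (simp add: horofunction_def)

lemma horofunction_base: "horofunction x0 z b \<Longrightarrow> b x0 = 0"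
  using horofunction_tendsto[of x0 z b x0] by (simp add: LIMSEQ_const_iff)

lemma horofunction_lipschitz:
  assumes "horofunction x0 z b" shows "b y - b y' \<le> dist y y'"
proof (rule tendsto_upperbound)
  show "(\<lambda>n. (dist (z n) y - dist (z n) x0) - (dist (z n) y' - dist (z n) x0)) \<longlonglongrightarrow> b y - b y'"
    by (intro tendsto_intros horofunction_tendsto assms)
  show "\<forall>\<^sub>F n in sequentially. (dist (z n) y - dist (z n) x0) - (dist (z n) y' - dist (z n) x0) \<le> dist y y'"
  proof (rule always_eventually, rule allI)
    fix n show "(dist (z n) y - dist (z n) x0) - (dist (z n) y' - dist (z n) x0) \<le> dist y y'"
      using dist_triangle[of "z n" y y'] by (simp add: dist_commute)
  qed
qed auto

lemma horofunction_abs_le_dist: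
  assumes "horofunction x0 z b" shows "\<bar>b y - b y'\<bar> \<le> dist y y'"
  using horofunction_lipschitz[OF assms, of y y'] horofunction_lipschitz[OF assms, of y' y]
  by (simp add: dist_commute)

lemma horofunction_convex_on_geodesic_line:
  fixes l :: "real \<Rightarrow> 'x::metric_space"
  assumes "CAT0_space TYPE('x)" "geodesic_line l" and b: "horofunction x0 z b"
  shows "convex_on UNIV (\<lambda>t. b (l t))"
proof (rule convex_onI)
  fix u s t :: real assume u: "0 < u" "u < 1"
  let ?h = "\<lambda>n y. dist (z n) y - dist (z n) x0"
  let ?m = "(1 - u) *\<^sub>R s + u *\<^sub>R t"
  show "b (l ?m) \<le> (1 - u) * b (l s) + u * b (l t)"
  proof (rule LIMSEQ_le)
    show "(\<lambda>n. ?h n (l ?m)) \<longlonglongrightarrow> b (l ?m)"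
      by (intro horofunction_tendsto b)
    show "(\<lambda>n. (1 - u) * ?h n (l s) + u * ?h n (l t)) \<longlonglongrightarrow> (1 - u) * b (l s) + u * b (l t)"
      by (intro tendsto_intros horofunction_tendsto b)
    have "dist (z n) (l ?m) \<le> (1 - u) * dist (z n) (l s) + u * dist (z n) (l t)" for n
      using convex_onD[OF convex_on_dist_geodesic_line[OF assms(1,2), of "z n"], of u s t] u by simp
    then show "\<exists>N. \<forall>n\<ge>N. ?h n (l ?m) \<le> (1 - u) * ?h n (l s) + u * ?h n (l t)"
      by (simp add: algebra_simps)
  qed
qed auto

text \<open>The point \<open>q\<close> lies at distance \<open>r\<close> from \<open>y\<close> on the gradient ray of \<open>- b\<close>; the inequality
  is the limit of the comparison inequality in the triangles \<open>p\<close>, \<open>y\<close>, \<open>z n\<close>.\<close>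

lemma horofunction_gradient_point:
  fixes b :: "'x::metric_space \<Rightarrow> real"
  assumes X: "CAT0_space TYPE('x)" "proper_metric_space TYPE('x)"
    and b: "horofunction x0 z b" and z: "filterlim (\<lambda>n. dist (z n) x0) at_top sequentially" and r: "0 \<le> r"
  shows "\<exists>q. b q = b y - r \<and>
    (\<forall>p. (dist p q)\<^sup>2 \<le> (dist p y)\<^sup>2 + r\<^sup>2 + 2 * r * (b p - b y))"
proof -
  define D where "D n = dist y (z n)" for n
  have D: "filterlim D at_top sequentially"
  proof (rule filterlim_at_top_mono)
    show "filterlim (\<lambda>n. - dist y x0 + dist (z n) x0) at_top sequentially"
      by (rule filterlim_tendsto_add_at_top[OF tendsto_const z])
    show "\<forall>\<^sub>F n in sequentially. - dist y x0 + dist (z n) x0 \<le> D n"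
    proof (rule always_eventually, rule allI)
      fix n show "- dist y x0 + dist (z n) x0 \<le> D n"
        using dist_triangle[of "z n" x0 y] by (simp add: D_def dist_commute)
    qed
  qed
  have "\<exists>c. geodesic_path c y (z n)" for n by (metis CAT0_geodesic[OF X(1)])
  then obtain c where c: "\<And>n. geodesic_path (c n) y (z n)" by metis
  \<comment> \<open>The minimum keeps \<open>u n\<close> in the unit interval for every
    \<open>n\<close>; as \<open>D n\<close> tends to infinity, eventually \<open>u n\<close> is
    \<open>r / D n\<close> and \<open>qn n\<close> is at distance \<open>r\<close> from
    \<open>y\<close>.\<close>
  define u where "u n = min 1 (r / D n)" for n
  define qn where "qn n = c n (u n * D n)" for n
  have Dpos: "\<forall>\<^sub>F n in sequentially. D n > r + 1"
    using D by (simp add: filterlim_at_top_dense)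
  have uD: "\<forall>\<^sub>F n in sequentially. u n = r / D n"
    using Dpos by eventually_elim (use r in \<open>simp add: u_def\<close>)
  have u01: "0 \<le> u n" "u n \<le> 1" for n using r by (auto simp: u_def D_def)
  have dq: "\<forall>\<^sub>F n in sequentially. dist y (qn n) = r \<and> dist (z n) (qn n) = D n - r"
    using Dpos uD
  proof eventually_elim
    case (elim n)
    have iso: "dist (c n s) (c n t) = \<bar>s - t\<bar>" if "s \<in> {0..D n}" "t \<in> {0..D n}" for s t
      using c[of n] that by (simp add: geodesic_path_def D_def)
    have ends: "c n 0 = y" "c n (D n) = z n"
      using c[of n] by (simp_all add: geodesic_path_def D_def)
    have "qn n = c n r" using elim r by (simp add: qn_def)
    then show ?case using iso[of 0 r] iso[of "D n" r] elim r unfolding ends by simp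
  qed
  have "\<exists>N. \<forall>n\<ge>N. qn n \<in> cball y r"
    using dq by (auto simp: eventually_sequentially)
  then obtain N where N: "\<And>n. qn (n + N) \<in> cball y r" by (metis le_add2)
  \<comment> \<open>Properness provides a limit \<open>q\<close> of the points at distance
    \<open>r\<close> on the segments from \<open>y\<close> to \<open>z n\<close>;
    \<open>\<kappa>\<close> is the corresponding subsequence, shifted by \<open>N\<close>.\<close>
  have "seq_compact (cball y r)"
    using X(2) by (simp add: proper_metric_space_def compact_imp_seq_compact)
  then obtain q \<kappa>' where \<kappa>': "strict_mono (\<kappa>'::nat \<Rightarrow> nat)" "((\<lambda>n. qn (n + N)) \<circ> \<kappa>') \<longlonglongrightarrow> q"
    using N seq_compactE[of "cball y r" "\<lambda>n. qn (n + N)"] by metis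
  define \<kappa> where "\<kappa> n = \<kappa>' n + N" for n
  have \<kappa>: "filterlim \<kappa> sequentially sequentially"
    unfolding \<kappa>_def by (intro filterlim_compose[OF filterlim_add_const_nat_at_top] filterlim_subseq \<kappa>')
  have q: "(\<lambda>n. qn (\<kappa> n)) \<longlonglongrightarrow> q" using \<kappa>'(2) by (simp add: o_def \<kappa>_def)
  note sub = filterlim_compose[OF _ \<kappa>]
  have hb: "(\<lambda>n. dist (z (\<kappa> n)) p - dist (z (\<kappa> n)) x0) \<longlonglongrightarrow> b p" for p
    by (rule sub[OF horofunction_tendsto[OF b]])
  have hb': "(\<lambda>n. dist (z (\<kappa> n)) p - D (\<kappa> n)) \<longlonglongrightarrow> b p - b y" for p
    using tendsto_diff[OF hb[of p] hb[of y]] by (simp add: D_def dist_commute)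
  have D': "filterlim (\<lambda>n. D (\<kappa> n)) at_top sequentially" by (rule sub[OF D])
  have ev: "\<forall>\<^sub>F n in sequentially. P (\<kappa> n)" if "eventually P sequentially" for P
    by (rule eventually_compose_filterlim[OF that \<kappa>])
  show ?thesis
  proof (intro exI[of _ q] conjI allI)
    have "(\<lambda>n. dist (z (\<kappa> n)) q - dist (z (\<kappa> n)) (qn (\<kappa> n))) \<longlonglongrightarrow> 0"
    proof (rule tendsto_0_le[where K = 1])
      show "(\<lambda>n. dist (qn (\<kappa> n)) q) \<longlonglongrightarrow> 0" by (rule iffD1[OF tendsto_dist_iff q])
      show "\<forall>\<^sub>F n in sequentially. norm (dist (z (\<kappa> n)) q - dist (z (\<kappa> n)) (qn (\<kappa> n)))
          \<le> norm (dist (qn (\<kappa> n)) q) * 1"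
      proof (rule always_eventually, rule allI)
        fix n
        show "norm (dist (z (\<kappa> n)) q - dist (z (\<kappa> n)) (qn (\<kappa> n))) \<le> norm (dist (qn (\<kappa> n)) q) * 1"
          using abs_dist_diff_le[of q "z (\<kappa> n)" "qn (\<kappa> n)"] by (simp add: dist_commute)
      qed
    qed
    moreover have "\<forall>\<^sub>F n in sequentially. dist (z (\<kappa> n)) q - dist (z (\<kappa> n)) (qn (\<kappa> n)) =
         (dist (z (\<kappa> n)) q - D (\<kappa> n)) + r"
      using ev[OF dq] by eventually_elim simp
    ultimately have "(\<lambda>n. (dist (z (\<kappa> n)) q - D (\<kappa> n)) + r) \<longlonglongrightarrow> 0"
      by (rule Lim_transform_eventually)
    moreover have "(\<lambda>n. (dist (z (\<kappa> n)) q - D (\<kappa> n)) + r) \<longlonglongrightarrow> b q - b y + r"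
      by (intro tendsto_intros hb')
    ultimately have "0 = b q - b y + r" by (rule LIMSEQ_unique)
    then show "b q = b y - r" by simp
  next
    fix p
    let ?d = "\<lambda>n. dist (z (\<kappa> n)) p - D (\<kappa> n)"
    have "(\<lambda>n. r / D (\<kappa> n)) \<longlonglongrightarrow> 0"
      by (rule tendsto_divide_0[OF tendsto_const filterlim_at_top_imp_at_infinity[OF D']])
    note R0 = tendsto_mult[OF tendsto_diff[OF tendsto_const[of 1] this] tendsto_const[of "(dist p y)\<^sup>2"]]
    have R1: "(\<lambda>n. r * (?d n)\<^sup>2 / D (\<kappa> n)) \<longlonglongrightarrow> 0"
      by (rule tendsto_divide_0[OF tendsto_mult[OF tendsto_const tendsto_power[OF hb']]
            filterlim_at_top_imp_at_infinity[OF D']])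
    \<comment> \<open>Write \<open>d\<close> for
      \<open>dist (z (\<kappa> n)) p - D (\<kappa> n)\<close>. Stewart's bound with
      \<open>u = r / D\<close> expands exactly to this expression, and the terms divided by
      \<open>D\<close> vanish in the limit.\<close>
    have R: "(\<lambda>n. (1 - r / D (\<kappa> n)) * (dist p y)\<^sup>2 + r\<^sup>2 + 2 * r * ?d n + r * (?d n)\<^sup>2 / D (\<kappa> n))
        \<longlonglongrightarrow> (1 - 0) * (dist p y)\<^sup>2 + r\<^sup>2 + 2 * r * (b p - b y) + 0"
      by (rule tendsto_add[OF tendsto_add[OF tendsto_add[OF R0 tendsto_const]
            tendsto_mult[OF tendsto_const hb']] R1])
    have L: "(\<lambda>n. (dist p (qn (\<kappa> n)))\<^sup>2) \<longlonglongrightarrow> (dist p q)\<^sup>2"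
      by (intro tendsto_intros q)
    have "\<forall>\<^sub>F n in sequentially. (dist p (qn (\<kappa> n)))\<^sup>2 \<le>
       (1 - r / D (\<kappa> n)) * (dist p y)\<^sup>2 + r\<^sup>2 + 2 * r * ?d n + r * (?d n)\<^sup>2 / D (\<kappa> n)"
      using ev[OF uD] ev[OF Dpos]
    proof eventually_elim
      case (elim n)
      let ?k = "\<kappa> n"
      have Dp: "D ?k > 0" using elim r by simp
      have "(dist p (qn ?k))\<^sup>2 \<le> (1 - u ?k) * (dist p y)\<^sup>2 + u ?k * (dist p (z ?k))\<^sup>2 - u ?k * (1 - u ?k) * (D ?k)\<^sup>2"
        using CAT0_stewart[OF X(1) c u01, of p ?k ?k] unfolding qn_def D_def .
      also have "\<dots> = (1 - r / D ?k) * (dist p y)\<^sup>2 + r\<^sup>2 + 2 * r * ?d n + r * (?d n)\<^sup>2 / D ?k"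
        using Dp unfolding elim(1) by (simp add: field_simps power2_eq_square dist_commute[of p "z _"])
      finally show ?case .
    qed
    then show "(dist p q)\<^sup>2 \<le> (dist p y)\<^sup>2 + r\<^sup>2 + 2 * r * (b p - b y)"
      using tendsto_le[OF sequentially_bot R L] by simp
  qed
qed

section \<open>Rays along which a horofunction decreases with unit speed, and the flat half-plane
  they span\<close>

lemma horofunction_ray_comparison:
  fixes b :: "'x::metric_space \<Rightarrow> real"
  assumes X: "CAT0_space TYPE('x)" "proper_metric_space TYPE('x)"
    and b: "horofunction x0 z b" "filterlim (\<lambda>n. dist (z n) x0) at_top sequentially"
    and \<rho>: "geodesic_ray \<rho>" "\<And>t. 0 \<le> t \<Longrightarrow> b (\<rho> t) = b (\<rho> 0) - t" and t: "0 \<le> t"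
  shows "(dist p (\<rho> t))\<^sup>2 \<le> (dist p (\<rho> 0))\<^sup>2 + t\<^sup>2 + 2 * t * (b p - b (\<rho> 0))"
proof -
  obtain q where q: "\<And>p. (dist p q)\<^sup>2 \<le> (dist p (\<rho> 0))\<^sup>2 + t\<^sup>2 + 2 * t * (b p - b (\<rho> 0))"
    using horofunction_gradient_point[OF X b t, of "\<rho> 0"] by blast
  \<comment> \<open>At \<open>p = \<rho> t\<close> the gradient inequality has right-hand side
    \<open>2 * t\<^sup>2 - 2 * t\<^sup>2\<close>, so the gradient point \<open>q\<close> coincides
    with \<open>\<rho> t\<close>.\<close>
  have "dist (\<rho> t) (\<rho> 0) = t" using \<rho>(1) t by (simp add: geodesic_ray_def)
  then have "(dist (\<rho> t) q)\<^sup>2 \<le> 0" using q[of "\<rho> t"] \<rho>(2)[OF t] by (simp add: power2_eq_square)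
  then have "q = \<rho> t" by simp
  then show ?thesis using q by simp
qed

text \<open>The comparison is applied twice: along \<open>\<rho>\<close> from the point
  \<open>\<rho>' t\<close>, and along \<open>\<rho>'\<close> from the point \<open>\<rho> 0\<close>.
  All terms in \<open>t\<close> cancel, so the distance between the rays never exceeds its initial
  value.\<close>

lemma horofunction_rays_asymptotic:
  fixes b :: "'x::metric_space \<Rightarrow> real"
  assumes X: "CAT0_space TYPE('x)" "proper_metric_space TYPE('x)"
    and b: "horofunction x0 z b" "filterlim (\<lambda>n. dist (z n) x0) at_top sequentially"
    and \<rho>: "geodesic_ray \<rho>" "\<And>t. 0 \<le> t \<Longrightarrow> b (\<rho> t) = b (\<rho> 0) - t"
    and \<rho>': "geodesic_ray \<rho>'" "\<And>t. 0 \<le> t \<Longrightarrow> b (\<rho>' t) = b (\<rho>' 0) - t"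
  shows "asymptotic_rays \<rho> \<rho>'"
  unfolding asymptotic_rays_def
proof (intro exI allI impI)
  fix t :: real assume t: "0 \<le> t"
  have 1: "(dist (\<rho>' t) (\<rho> t))\<^sup>2 \<le> (dist (\<rho>' t) (\<rho> 0))\<^sup>2 + t\<^sup>2 + 2 * t * (b (\<rho>' 0) - t - b (\<rho> 0))"
    using horofunction_ray_comparison[OF X b \<rho> t, of "\<rho>' t"] \<rho>'(2)[OF t] by simp
  have 2: "(dist (\<rho> 0) (\<rho>' t))\<^sup>2 \<le> (dist (\<rho> 0) (\<rho>' 0))\<^sup>2 + t\<^sup>2 + 2 * t * (b (\<rho> 0) - b (\<rho>' 0))"
    using horofunction_ray_comparison[OF X b \<rho>' t, of "\<rho> 0"] by simp
  have "(dist (\<rho> t) (\<rho>' t))\<^sup>2 \<le> (dist (\<rho> 0) (\<rho>' 0))\<^sup>2"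
    using 1 2 by (simp add: dist_commute power2_eq_square algebra_simps)
  then show "dist (\<rho> t) (\<rho>' t) \<le> dist (\<rho> 0) (\<rho>' 0)" by (rule power2_le_imp_le) simp
qed

lemma boundary_point_eq_if_asymptotic:
  assumes "asymptotic_rays \<rho> \<rho>'"
  shows "boundary_point \<rho> = boundary_point \<rho>'"
proof -
  obtain B where B: "\<And>t. t \<ge> 0 \<Longrightarrow> dist (\<rho> t) (\<rho>' t) \<le> B" using assms by (auto simp: asymptotic_rays_def)
  have "asymptotic_rays \<rho> \<tau> \<longleftrightarrow> asymptotic_rays \<rho>' \<tau>" for \<tau>
  proof
    assume "asymptotic_rays \<rho> \<tau>"
    then obtain C where "\<And>t. t \<ge> 0 \<Longrightarrow> dist (\<rho> t) (\<tau> t) \<le> C" by (auto simp: asymptotic_rays_def)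
    then show "asymptotic_rays \<rho>' \<tau>" unfolding asymptotic_rays_def using B
      by (intro exI[of _ "B + C"] allI impI) (metis add_mono dist_commute dist_triangle order_trans)
  next
    assume "asymptotic_rays \<rho>' \<tau>"
    then obtain C where "\<And>t. t \<ge> 0 \<Longrightarrow> dist (\<rho>' t) (\<tau> t) \<le> C" by (auto simp: asymptotic_rays_def)
    then show "asymptotic_rays \<rho> \<tau>" unfolding asymptotic_rays_def using B
      by (intro exI[of _ "B + C"] allI impI) (metis add_mono dist_triangle order_trans)
  qed
  then show ?thesis by (simp add: boundary_point_def)
qed

text \<open>The half-plane is parametrised by oblique coordinates: \<open>t\<close> along
  \<open>l\<close>, then \<open>r\<close> along the gradient ray from \<open>l t\<close>. Slope
  \<open>- s\<close> of \<open>b\<close> means that these directions meet at an angle of cosine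
  \<open>s\<close>, and \<open>\<bar>s\<bar> < 1\<close> keeps the plane from collapsing. The
  gradient inequality bounds distances from above, and triangles with a vertex on \<open>l\<close>
  bound them from below.\<close>

lemma bounds_flat_half_plane_if_affine_horofunction:
  fixes l :: "real \<Rightarrow> 'x::metric_space"
  assumes X: "CAT0_space TYPE('x)" "proper_metric_space TYPE('x)"
    and b: "horofunction x0 z b" "filterlim (\<lambda>n. dist (z n) x0) at_top sequentially"
    and l: "geodesic_line l" and s: "\<bar>s\<bar> < 1" and bl: "\<And>t. b (l t) = \<beta> - s * t"
  shows "bounds_flat_half_plane l"
proof -
  define G where "G t r q \<longleftrightarrow> b q = b (l t) - r \<and>
    (\<forall>p. (dist p q)\<^sup>2 \<le> (dist p (l t))\<^sup>2 + r\<^sup>2 + 2 * r * (b p - b (l t)))" for t r q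
  define \<rho> where "\<rho> t r = (SOME q. G t r q)" for t r
  have G: "G t r (\<rho> t r)" if "0 \<le> r" for t r
    unfolding \<rho>_def using horofunction_gradient_point[OF X b that, of "l t"]
    by (intro someI_ex[of "G t r"]) (simp add: G_def)
  have \<rho>: "b (\<rho> t r) = b (l t) - r"
    "(dist p (\<rho> t r))\<^sup>2 \<le> (dist p (l t))\<^sup>2 + r\<^sup>2 + 2 * r * (b p - b (l t))" if "0 \<le> r" for t r p
    using G[OF that] by (simp_all add: G_def)
  have dl: "(dist (l t') (l t))\<^sup>2 = (t' - t)\<^sup>2" for t t'
    using l by (simp add: geodesic_line_def)
  have \<rho>0: "\<rho> t 0 = l t" for t using \<rho>(2)[of 0 "l t" t] by simp
  \<comment> \<open>\<open>E t r\<close> is the squared length of a vector with oblique coordinates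
    \<open>t\<close> and \<open>r\<close> with respect to unit vectors of inner product
    \<open>s\<close>.\<close>
  define E where "E t r = t\<^sup>2 + 2 * s * t * r + r\<^sup>2" for t r :: real
  have E_alt: "E t r = (t + s * r)\<^sup>2 + (1 - s\<^sup>2) * r\<^sup>2" for t r
    by (simp add: E_def power2_eq_square algebra_simps)
  have s2: "1 - s\<^sup>2 > 0" using s by (simp add: abs_square_less_1)
  have E_nonneg: "E t r \<ge> 0" for t r unfolding E_alt using s2 by simp
  have dist_l: "(dist (\<rho> t r) (l t'))\<^sup>2 = E (t - t') r" if r: "r \<ge> 0" for t r t'
  proof -
    \<comment> \<open>\<open>h\<close> is the defect between the actual and the Euclidean squared
      distance. It is convex, being \<open>(dist (\<rho> t r) (l t'))\<^sup>2 - t'\<^sup>2\<close>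
      plus an affine function, and nonpositive by the gradient inequality, hence constant. At
      \<open>t' = t\<close> it is nonnegative, because \<open>b\<close> drops by \<open>r\<close>;
      so it vanishes.\<close>
    define h where "h t' = (dist (\<rho> t r) (l t'))\<^sup>2 - t'\<^sup>2 + (t' * (2 * t + 2 * s * r) - (t\<^sup>2 + 2 * s * t * r + r\<^sup>2))" for t'
    have h_eq: "h t' = (dist (\<rho> t r) (l t'))\<^sup>2 - E (t - t') r" for t'
      by (simp add: h_def E_def power2_eq_square algebra_simps)
    have "convex_on UNIV h" unfolding h_def
      by (intro convex_on_add convex_on_dist_square_geodesic_line X l)
        (auto intro!: convex_onI simp: algebra_simps)
    moreover have "h t' \<le> 0" for t'
      using \<rho>(2)[OF r, of "l t'" t] unfolding h_eq dl bl
      by (simp add: E_def dist_commute power2_eq_square algebra_simps)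
    ultimately have "h t' = h t" by (rule convex_on_bounded_above_const)
    moreover have "h t \<ge> 0"
    proof -
      have "r \<le> dist (l t) (\<rho> t r)"
        using horofunction_lipschitz[OF b(1), of "l t" "\<rho> t r"] \<rho>(1)[OF r] by simp
      then have "r\<^sup>2 \<le> (dist (\<rho> t r) (l t))\<^sup>2" using r unfolding dist_commute[of "\<rho> t r"] by (intro power_mono)
      then show ?thesis by (simp add: h_eq E_def)
    qed
    ultimately show ?thesis using \<open>h t' \<le> 0\<close> by (simp add: h_eq)
  qed
  have le: "(dist (\<rho> t' r') (\<rho> t r))\<^sup>2 \<le> E (t' - t) (r' - r)" if r: "r \<ge> 0" "r' \<ge> 0" for t r t' r'
    using \<rho>(2)[OF r(1), of "\<rho> t' r'" t] unfolding dist_l[OF r(2)] \<rho>(1)[OF r(2)] bl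
    by (simp add: E_def power2_eq_square algebra_simps)
  text \<open>The line through the two points meets the boundary line in \<open>l \<tau>\<close>.\<close>
  have ge_less: "sqrt (E (t' - t) (r' - r)) \<le> dist (\<rho> t' r') (\<rho> t r)" if r: "r \<ge> 0" "r < r'" for t r t' r'
  proof -
    define k where "k = r / (r' - r)"
    define \<tau> where "\<tau> = t - (t' - t) * k"
    define W where "W = sqrt (E (t' - t) (r' - r))"
    have k: "k \<ge> 0" "k * (r' - r) = r" "(k + 1) * (r' - r) = r'"
      using r by (simp_all add: k_def field_simps)
    have Ek: "E (j * x) (j * y) = j\<^sup>2 * E x y" for j x y
      by (simp add: E_def power2_eq_square algebra_simps)
    have "(dist (\<rho> t r) (l \<tau>))\<^sup>2 = E (k * (t' - t)) (k * (r' - r))"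
      unfolding dist_l[OF r(1)] k(2) \<tau>_def by (simp add: mult.commute)
    also have "\<dots> = (k * W)\<^sup>2" unfolding Ek W_def by (simp add: power_mult_distrib E_nonneg)
    finally have 1: "dist (\<rho> t r) (l \<tau>) = k * W"
      using k(1) by (simp add: W_def E_nonneg)
    have "(dist (\<rho> t' r') (l \<tau>))\<^sup>2 = E ((k + 1) * (t' - t)) ((k + 1) * (r' - r))"
      using r dist_l[of r' t' \<tau>] unfolding k(3) \<tau>_def by (simp add: algebra_simps)
    also have "\<dots> = ((k + 1) * W)\<^sup>2" unfolding Ek W_def by (simp add: power_mult_distrib E_nonneg)
    finally have 2: "dist (\<rho> t' r') (l \<tau>) = (k + 1) * W"
      using k(1) by (simp add: W_def E_nonneg)
    show ?thesis using 1 2 dist_triangle[of "\<rho> t' r'" "l \<tau>" "\<rho> t r"] by (simp add: W_def algebra_simps)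
  qed
  have ge: "sqrt (E (t' - t) (r' - r)) \<le> dist (\<rho> t' r') (\<rho> t r)" if r: "r \<ge> 0" "r' \<ge> 0" for t r t' r'
  proof (cases r r' rule: linorder_cases)
    case less
    then show ?thesis using ge_less r by blast
  next
    case greater
    have "E (t' - t) (r' - r) = E (t - t') (r - r')" by (simp add: E_def power2_eq_square algebra_simps)
    then show ?thesis using ge_less[OF r(2) greater, of t t'] by (simp add: dist_commute)
  next
    case equal
    \<comment> \<open>At equal heights the line through the two points is parallel to
      \<open>l\<close> and misses it. One point is therefore raised by \<open>e\<close>, which moves
      it by at most \<open>e\<close>, and \<open>e\<close> tends to 0.\<close>
    have "sqrt (E (t' - t) e) - e \<le> dist (\<rho> t' r') (\<rho> t r)" if e: "e > 0" for e
    proof -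
      have "sqrt (E (t' - t) e) \<le> dist (\<rho> t' (r' + e)) (\<rho> t r)"
        using ge_less[of r "r' + e" t' t] r e equal by simp
      moreover have "(dist (\<rho> t' (r' + e)) (\<rho> t' r'))\<^sup>2 \<le> e\<^sup>2"
        using le[of r' "r' + e" t' t'] r e by (simp add: E_def)
      then have "dist (\<rho> t' (r' + e)) (\<rho> t' r') \<le> e" using e by (auto intro: power2_le_imp_le)
      moreover have "dist (\<rho> t' (r' + e)) (\<rho> t r) \<le> dist (\<rho> t' (r' + e)) (\<rho> t' r') + dist (\<rho> t' r') (\<rho> t r)"
        by (rule dist_triangle)
      ultimately show ?thesis by linarith
    qed
    then have "\<forall>\<^sub>F e in at_right 0. sqrt (E (t' - t) e) - e \<le> dist (\<rho> t' r') (\<rho> t r)"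
      by (simp add: eventually_at_right_less eventually_mono[OF eventually_at_right_less])
    moreover have "((\<lambda>e. sqrt (E (t' - t) e) - e) \<longlongrightarrow> sqrt (E (t' - t) 0) - 0) (at_right 0)"
      unfolding E_def by (intro tendsto_intros)
    ultimately show ?thesis using equal by (intro tendsto_upperbound[of _ _ "at_right (0::real)"]) auto
  qed
  have dist_\<rho>: "dist (\<rho> t' r') (\<rho> t r) = sqrt (E (t' - t) (r' - r))" if r: "r \<ge> 0" "r' \<ge> 0" for t r t' r'
    using ge[OF r, of t' t] le[OF r, of t' t] by (simp add: antisym real_le_rsqrt)
  \<comment> \<open>\<open>c\<close> is the sine of the angle between \<open>l\<close> and the
    gradient rays; \<open>F\<close> converts Cartesian coordinates into the oblique ones.\<close>
  define c where "c = sqrt (1 - s\<^sup>2)"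
  have c: "c > 0" "c\<^sup>2 = 1 - s\<^sup>2" using s2 by (simp_all add: c_def)
  define F where "F w = \<rho> (Re w - s * (Im w / c)) (Im w / c)" for w
  have "dist (F w) (F w') = cmod (w - w')" if "Im w \<ge> 0" "Im w' \<ge> 0" for w w'
  proof -
    have "E (Re w - s * (Im w / c) - (Re w' - s * (Im w' / c))) (Im w / c - Im w' / c)
        = (Re w - Re w')\<^sup>2 + c\<^sup>2 * (Im w / c - Im w' / c)\<^sup>2"
      unfolding E_alt c(2) by (simp add: algebra_simps)
    also have "c\<^sup>2 * (Im w / c - Im w' / c)\<^sup>2 = (Im w - Im w')\<^sup>2"
      using c(1) by (simp add: power_mult_distrib[symmetric] algebra_simps)
    finally show ?thesis
      using that c(1) unfolding F_def by (subst dist_\<rho>) (simp_all add: cmod_def)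
  qed
  moreover have "F ` {w. Im w = 0} = range l"
  proof -
    have F_real: "F w = l (Re w)" if "Im w = 0" for w using that by (simp add: F_def \<rho>0)
    have "F ` {w. Im w = 0} \<subseteq> range l" using F_real by auto
    moreover have "l t \<in> F ` {w. Im w = 0}" for t
      using F_real[of "complex_of_real t"] by (intro image_eqI[of _ _ "complex_of_real t"]) simp_all
    ultimately show ?thesis by auto
  qed
  ultimately show ?thesis unfolding bounds_flat_half_plane_def by blast
qed

section \<open>Invariant measures on horofunctions\<close>

text \<open>Equal increments make \<open>b\<close> affine on the multiples of \<open>a\<close>.
  Removing this affine part leaves a convex function that is bounded above, as \<open>b\<close> is
  Lipschitz and every parameter is within \<open>a\<close> of a multiple of \<open>a\<close>; such a
  function is constant.\<close>

lemma horofunction_affine_on_geodesic_line: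
  fixes l :: "real \<Rightarrow> 'x::metric_space"
  assumes X: "CAT0_space TYPE('x)" and l: "geodesic_line l" and b: "horofunction x0 z b" and a: "a > 0"
    and step: "\<And>n::int. b (l (of_int n * a)) - b (l (of_int (n + 1) * a)) =
        b (l (of_int (n - 1) * a)) - b (l (of_int n * a))"
  shows "\<exists>s. \<bar>s\<bar> \<le> 1 \<and> (\<forall>t. b (l t) = b (l 0) - s * t)"
proof -
  define F where "F n = b (l (of_int n * a)) - b (l (of_int (n + 1) * a))" for n :: int
  have F_step: "F n = F (n - 1)" for n using step[of n] by (simp add: F_def)
  have F0: "F n = F 0" for n
    by (induction n rule: int_induct[where k = 0]) (use F_step F_step[of "_ + 1"] in auto)
  have bn: "b (l (of_int n * a)) = b (l 0) - of_int n * F 0" for n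
  proof (induction n rule: int_induct[where k = 0])
    case (step1 n)
    then show ?case using F0[of n] by (simp add: F_def algebra_simps)
  next
    case (step2 n)
    then show ?case using F0[of "n - 1"] by (simp add: F_def algebra_simps)
  qed simp
  have lip: "\<bar>b (l s) - b (l t)\<bar> \<le> \<bar>s - t\<bar>" for s t
    using horofunction_abs_le_dist[OF b, of "l s" "l t"] l by (simp add: geodesic_line_def)
  define s where "s = F 0 / a"
  have sa: "s * a = F 0" using a by (simp add: s_def)
  define h where "h t = b (l t) + t * s" for t
  have "convex_on UNIV h" unfolding h_def
    by (intro convex_on_add horofunction_convex_on_geodesic_line[OF X l b])
      (auto intro!: convex_onI simp: algebra_simps)
  moreover have "h t \<le> b (l 0) + (1 + \<bar>s\<bar>) * a" for t
  proof -
    define n where "n = \<lfloor>t / a\<rfloor>"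
    have "of_int n \<le> t / a" "t / a < of_int n + 1" by (simp_all add: n_def)
    then have n: "\<bar>t - of_int n * a\<bar> \<le> a" using a by (simp add: field_simps)
    have hn: "h (of_int n * a) = b (l 0)" using bn[of n] sa by (simp add: h_def mult.assoc mult.commute[of a])
    have "h t - h (of_int n * a) = (b (l t) - b (l (of_int n * a))) + s * (t - of_int n * a)"
      by (simp add: h_def algebra_simps)
    also have "\<dots> \<le> \<bar>t - of_int n * a\<bar> + \<bar>s\<bar> * \<bar>t - of_int n * a\<bar>"
      using lip[of t "of_int n * a"] abs_ge_self[of "s * (t - of_int n * a)"] by (simp add: abs_mult)
    also have "\<dots> = (1 + \<bar>s\<bar>) * \<bar>t - of_int n * a\<bar>" by (simp add: algebra_simps)
    also have "\<dots> \<le> (1 + \<bar>s\<bar>) * a" using n by (intro mult_left_mono) auto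
    finally show ?thesis using hn by simp
  qed
  ultimately have h_const: "h t = h 0" for t by (rule convex_on_bounded_above_const)
  have eq: "b (l t) = b (l 0) - s * t" for t
    using h_const[of t] by (simp add: h_def algebra_simps)
  have "\<bar>s\<bar> \<le> 1" using lip[of 1 0] eq[of 1] by simp
  with eq show ?thesis by blast
qed

text \<open>In the direction of \<open>l\<close> in which \<open>b\<close> does not increase,
  \<open>b\<close> stays below \<open>\<beta> + 1\<close>. Hence eventually \<open>z n\<close> is
  not much farther from \<open>l t\<close> than from \<open>x0\<close>, which for large
  \<open>\<bar>t\<bar>\<close> forces \<open>z n\<close> to be far from \<open>x0\<close>.\<close>

lemma horofunction_affine_escapes:
  fixes l :: "real \<Rightarrow> 'x::metric_space"
  assumes l: "geodesic_line l" and b: "horofunction x0 z b" and bl: "\<And>t. b (l t) = \<beta> - s * t"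
  shows "filterlim (\<lambda>n. dist (z n) x0) at_top sequentially"
proof (subst filterlim_at_top, intro allI)
  fix Z :: real
  \<comment> \<open>Two triangle inequalities bound \<open>\<bar>t\<bar>\<close> by
    \<open>2 * dist (z n) x0 + \<beta> + 1 + dist (l 0) x0\<close>; \<open>T\<close> is chosen so
    that this gives the bound \<open>Z\<close>.\<close>
  define T where "T = max 0 (2 * Z + \<beta> + 1 + dist (l 0) x0)"
  define t where "t = (if s \<ge> 0 then T else - T)"
  have T: "T \<ge> 0" "T \<ge> 2 * Z + \<beta> + 1 + dist (l 0) x0" by (auto simp: T_def)
  have t: "\<bar>t\<bar> = T" "s * t \<ge> 0" using T(1) by (auto simp: t_def mult_nonpos_nonneg)
  have "b (l t) < \<beta> + 1" using bl[of t] t by simp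
  then have "\<forall>\<^sub>F n in sequentially. dist (z n) (l t) - dist (z n) x0 < \<beta> + 1"
    using order_tendstoD(2)[OF horofunction_tendsto[OF b]] by blast
  then show "\<forall>\<^sub>F n in sequentially. Z \<le> dist (z n) x0"
  proof eventually_elim
    case (elim n)
    have "dist (l t) (l 0) = T" using l t by (simp add: geodesic_line_def)
    moreover have "dist (l t) (l 0) \<le> dist (l t) x0 + dist (l 0) x0" by (rule dist_triangle2)
    moreover have "dist (l t) x0 \<le> dist (z n) (l t) + dist (z n) x0" by (rule dist_triangle3)
    ultimately show ?case using elim T by linarith
  qed
qed

text \<open>The measure lives on an abstract space whose points are read as horofunctions through
  \<open>H\<close>. Measurability of evaluations and the transformation rule \<open>H_A\<close>,
  which renormalises at \<open>x0\<close>, form the interface to the compactification.\<close>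

lemma no_invariant_horofunction_measure:
  fixes \<phi> :: "'g \<Rightarrow> 'x::metric_space \<Rightarrow> 'x" and M :: "'w measure" and H :: "'w \<Rightarrow> 'x \<Rightarrow> real"
  assumes X: "CAT0_space TYPE('x)" "proper_metric_space TYPE('x)"
    and G: "group G" "isometric_action G \<phi>" "nonelementary_action G \<phi>"
    and k: "k \<in> carrier G" "rank_one_isometry (\<phi> k)"
    and M: "prob_space M"
    and H_measurable: "\<And>y. (\<lambda>w. H w y) \<in> borel_measurable M"
    and H: "\<And>w. w \<in> space M \<Longrightarrow> \<exists>z. horofunction x0 z (H w)"
    and A_measurable: "\<And>g. g \<in> carrier G \<Longrightarrow> A g \<in> measurable M M"
    and A_invariant: "\<And>g. g \<in> carrier G \<Longrightarrow> distr M M (A g) = M"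
    and H_A: "\<And>g w y. \<lbrakk>g \<in> carrier G; w \<in> space M\<rbrakk> \<Longrightarrow>
      H (A g w) y = H w (\<phi> (inv\<^bsub>G\<^esub> g) y) - H w (\<phi> (inv\<^bsub>G\<^esub> g) x0)"
  shows False
proof -
  interpret prob_space M by (rule M)
  interpret \<phi>: group_action G UNIV \<phi> using G(2) by (simp add: isometric_action_def)
  obtain l a where l: "geodesic_line l" and a: "a > 0" and kl: "\<And>t. \<phi> k (l t) = l (t + a)"
    and flat: "\<not> bounds_flat_half_plane l"
    using k(2) by (auto simp: rank_one_isometry_def)
  have kl': "\<phi> (inv\<^bsub>G\<^esub> k) (l t) = l (t - a)" for t
    using \<phi>.orbit_sym_aux[OF k(1), of "l (t - a)" "l t"] kl[of "t - a"] by simp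
  define F where "F n w = H w (l (of_int n * a)) - H w (l (of_int (n + 1) * a))" for n :: int and w
  have F_measurable: "F n \<in> borel_measurable M" for n
    unfolding F_def by (intro borel_measurable_diff H_measurable)
  have F_bound: "\<bar>F n w\<bar> \<le> a" if w: "w \<in> space M" for n w
  proof -
    obtain z where "horofunction x0 z (H w)" using H[OF w] by blast
    from horofunction_abs_le_dist[OF this, of "l (of_int n * a)" "l (of_int (n + 1) * a)"]
    show ?thesis using l a by (simp add: F_def geodesic_line_def algebra_simps)
  qed
  have F_int: "integrable M (F n)" for n
    by (rule integrable_const_bound[of _ a]) (use F_bound F_measurable in auto)
  have F_mono: "F n w \<le> F (n - 1) w" if w: "w \<in> space M" for n w
  proof -
    obtain z where z: "horofunction x0 z (H w)" using H[OF w] by blast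
    have "(1 - 1/2) *\<^sub>R (of_int (n - 1) * a) + (1/2) *\<^sub>R (of_int (n + 1) * a) = of_int n * a"
      by (simp add: algebra_simps)
    then have "H w (l (of_int n * a)) \<le> (1 - 1/2) * H w (l (of_int (n - 1) * a)) + (1/2) * H w (l (of_int (n + 1) * a))"
      using convex_onD[OF horofunction_convex_on_geodesic_line[OF X(1) l z], of "1/2"
          "of_int (n - 1) * a" "of_int (n + 1) * a"] by simp
    then show ?thesis by (simp add: F_def)
  qed
  have F_shift: "F n (A k w) = F (n - 1) w" if w: "w \<in> space M" for n w
    using w by (simp add: F_def H_A k(1) kl' algebra_simps)
  \<comment> \<open>By \<open>F_shift\<close> and invariance under \<open>k\<close>, both functions
    have the same integral; together with the pointwise order \<open>F_mono\<close> this forces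
    equality almost everywhere.\<close>
  have "AE w in M. F n w = F (n - 1) w" for n
  proof -
    have "integral\<^sup>L M (F n) = integral\<^sup>L (distr M M (A k)) (F n)"
      by (simp add: A_invariant k(1))
    also have "\<dots> = (\<integral>w. F n (A k w) \<partial>M)"
      by (intro integral_distr A_measurable k F_measurable)
    also have "\<dots> = integral\<^sup>L M (F (n - 1))"
      by (intro Bochner_Integration.integral_cong refl F_shift)
    finally have "(\<integral>w. F (n - 1) w - F n w \<partial>M) = 0" by (simp add: F_int)
    then have "AE w in M. F (n - 1) w - F n w = 0"
      by (subst (asm) integral_nonneg_eq_0_iff_AE) (use F_int F_mono in auto)
    then show ?thesis by (rule AE_mp) (rule AE_I2, simp)
  qed
  then have AE_step: "AE w in M. \<forall>n. F n w = F (n - 1) w" by (simp add: AE_all_countable)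
  define B where "B \<sigma> w \<longleftrightarrow> (\<forall>t. H w (l t) = H w (l 0) - \<sigma> * t)" for \<sigma> w
  have AE_B: "AE w in M. B 1 w \<or> B (-1) w"
    using AE_step
  proof (rule AE_mp, intro AE_I2 impI)
    fix w assume w: "w \<in> space M" and F: "\<forall>n. F n w = F (n - 1) w"
    obtain z where z: "horofunction x0 z (H w)" using H[OF w] by blast
    have "H w (l (of_int n * a)) - H w (l (of_int (n + 1) * a)) =
        H w (l (of_int (n - 1) * a)) - H w (l (of_int n * a))" for n
      using F[rule_format, of n] by (simp add: F_def)
    from horofunction_affine_on_geodesic_line[OF X(1) l z a this]
    obtain s where s: "\<bar>s\<bar> \<le> 1" "\<And>t. H w (l t) = H w (l 0) - s * t" by blast
    have "\<not> \<bar>s\<bar> < 1"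
      using bounds_flat_half_plane_if_affine_horofunction[OF X z
          horofunction_affine_escapes[OF l z s(2)] l _ s(2)] flat by blast
    then have "s = 1 \<or> s = -1" using s(1) by linarith
    moreover have "B s w" unfolding B_def using s(2) by (rule allI)
    ultimately show "B 1 w \<or> B (-1) w" by auto
  qed
  \<comment> \<open>Positivity of measure is expressed by denying that the complement has full
    measure, which avoids a measurability argument for \<open>B\<close>.\<close>
  have "\<not> ((AE w in M. \<not> B 1 w) \<and> (AE w in M. \<not> B (-1) w))"
  proof (rule notI, elim conjE)
    assume "AE w in M. \<not> B 1 w" "AE w in M. \<not> B (-1) w"
    with AE_B have "AE w in M. False" by eventually_elim blast
    then show False by simp
  qed
  then obtain \<sigma> where \<sigma>: "\<sigma> = 1 \<or> \<sigma> = -1" and not_null: "\<not> (AE w in M. \<not> B \<sigma> w)" by blast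
  define \<rho> where "\<rho> \<tau> t = l (\<tau> * t)" for \<tau> t
  have ray: "geodesic_ray (\<rho> \<tau>)" if "\<tau> = 1 \<or> \<tau> = -1" for \<tau>
    using l that by (auto simp: geodesic_ray_def geodesic_line_def \<rho>_def)
  have "boundary_point (\<phi> g \<circ> \<rho> \<sigma>) \<in> {boundary_point (\<rho> 1), boundary_point (\<rho> (-1))}"
    if g: "g \<in> carrier G" for g
  proof -
    have "AE w in distr M M (A g). B 1 w \<or> B (-1) w" using AE_B unfolding A_invariant[OF g] .
    then have AE_A: "AE w in M. B 1 (A g w) \<or> B (-1) (A g w)"
      by (rule AE_distrD[OF A_measurable[OF g]])
    \<comment> \<open>A set that is not null meets a set of full measure. For such \<open>w\<close>
      the horofunction \<open>H (A g w)\<close> decreases with unit speed both along the translate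
      by \<open>g\<close> of \<open>\<rho> \<sigma>\<close> and along one of the two rays of
      \<open>l\<close>.\<close>
    have "\<exists>w\<in>space M. B \<sigma> w \<and> (B 1 (A g w) \<or> B (-1) (A g w))"
    proof (rule ccontr)
      assume "\<not> ?thesis"
      then have "AE w in M. \<not> (B \<sigma> w \<and> (B 1 (A g w) \<or> B (-1) (A g w)))" by (intro AE_I2) blast
      with AE_A have "AE w in M. \<not> B \<sigma> w" by eventually_elim blast
      with not_null show False ..
    qed
    then obtain w where w: "w \<in> space M" "B \<sigma> w" "B 1 (A g w) \<or> B (-1) (A g w)" by blast
    then obtain \<tau> where \<tau>: "\<tau> = 1 \<or> \<tau> = -1" "B \<tau> (A g w)" by blast
    have "A g w \<in> space M" using measurable_space[OF A_measurable[OF g] w(1)] .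
    from H[OF this] obtain z where z: "horofunction x0 z (H (A g w))" by (elim exE)
    have Bw: "H w (l t) = H w (l 0) - \<sigma> * t" for t using w(2) unfolding B_def by (rule spec)
    have BA: "H (A g w) (l t) = H (A g w) (l 0) - \<tau> * t" for t using \<tau>(2) unfolding B_def by (rule spec)
    have z': "filterlim (\<lambda>n. dist (z n) x0) at_top sequentially"
      by (rule horofunction_affine_escapes[OF l z BA])
    have "\<phi> (inv\<^bsub>G\<^esub> g) (\<phi> g x) = x" for x using \<phi>.orbit_sym_aux[OF g] by simp
    then have 1: "H (A g w) ((\<phi> g \<circ> \<rho> \<sigma>) t) = H (A g w) ((\<phi> g \<circ> \<rho> \<sigma>) 0) - t" for t
      using Bw[of "\<sigma> * t"] \<sigma> by (auto simp: H_A[OF g w(1)] \<rho>_def)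
    have 2: "H (A g w) (\<rho> \<tau> t) = H (A g w) (\<rho> \<tau> 0) - t" for t
      using BA[of "\<tau> * t"] \<tau>(1) by (auto simp: \<rho>_def)
    have "geodesic_ray (\<phi> g \<circ> \<rho> \<sigma>)"
      using ray[OF \<sigma>] G(2) g by (simp add: geodesic_ray_def isometric_action_def isometry_of_def)
    then have "asymptotic_rays (\<phi> g \<circ> \<rho> \<sigma>) (\<rho> \<tau>)"
      by (rule horofunction_rays_asymptotic[OF X z z' _ 1 ray[OF \<tau>(1)] 2])
    then have "boundary_point (\<phi> g \<circ> \<rho> \<sigma>) = boundary_point (\<rho> \<tau>)"
      by (rule boundary_point_eq_if_asymptotic)
    then show ?thesis using \<tau>(1) by auto
  qed
  then have "(\<lambda>g. boundary_point (\<phi> g \<circ> \<rho> \<sigma>)) ` carrier G \<subseteq> {boundary_point (\<rho> 1), boundary_point (\<rho> (-1))}"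
    by blast
  then have "finite ((\<lambda>g. boundary_point (\<phi> g \<circ> \<rho> \<sigma>)) ` carrier G)" by (rule finite_subset) simp
  then show False using G(3) ray[OF \<sigma>] unfolding nonelementary_action_def by blast
qed

section \<open>Topological and measure-theoretic preliminaries\<close>

text \<open>The quadrilateral inequality is used for both ways of pairing \<open>p\<close>,
  \<open>q\<close> with \<open>y\<close>, \<open>x0\<close>. The squares of the large distances
  cancel, replacing \<open>Q\<close> by \<open>P\<close> costs at most \<open>d * R\<close>, and
  division by \<open>2 * P\<close> makes the error small when \<open>p\<close> is far away.\<close>

lemma CAT0_horofunction_near:
  fixes p q y x0 :: "'x::metric_space"
  assumes X: "CAT0_space TYPE('x)" and p: "dist p x0 > 0"
  shows "\<bar>(dist p y - dist p x0) - (dist q y - dist q x0)\<bar> \<le> (dist p q + 2 * dist y x0)\<^sup>2 / (2 * dist p x0)"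
proof -
  define P Q R d \<beta> \<gamma> where "P = dist p x0" and "Q = dist q x0" and "R = dist y x0" and "d = dist p q"
    and "\<beta> = dist p y - dist p x0" and "\<gamma> = dist q y - dist q x0"
  have 1: "(P + \<beta>)\<^sup>2 + Q\<^sup>2 \<le> d\<^sup>2 + (Q + \<gamma>)\<^sup>2 + R\<^sup>2 + P\<^sup>2"
    using CAT0_quadrilateral[OF X, of p y q x0]
    by (simp add: P_def Q_def R_def d_def \<beta>_def \<gamma>_def dist_commute)
  have 2: "(Q + \<gamma>)\<^sup>2 + P\<^sup>2 \<le> d\<^sup>2 + (P + \<beta>)\<^sup>2 + R\<^sup>2 + Q\<^sup>2"
    using CAT0_quadrilateral[OF X, of q y p x0]
    by (simp add: P_def Q_def R_def d_def \<beta>_def \<gamma>_def dist_commute)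
  have \<beta>: "\<bar>\<beta>\<bar> \<le> R" and \<gamma>: "\<bar>\<gamma>\<bar> \<le> R" and PQ: "\<bar>P - Q\<bar> \<le> d"
    using abs_dist_diff_le[of y p x0] abs_dist_diff_le[of y q x0] abs_dist_diff_le[of p x0 q]
    by (simp_all add: P_def Q_def R_def d_def \<beta>_def \<gamma>_def dist_commute)
  have sq: "\<beta>\<^sup>2 \<le> R\<^sup>2" "\<gamma>\<^sup>2 \<le> R\<^sup>2" using \<beta> \<gamma> by (auto simp: abs_le_square_iff[symmetric])
  have "\<bar>(P - Q) * \<gamma>\<bar> \<le> d * R" using PQ \<gamma> unfolding abs_mult by (intro mult_mono) auto
  then have m: "\<bar>P * \<gamma> - Q * \<gamma>\<bar> \<le> d * R" by (simp add: algebra_simps)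
  have "\<beta>\<^sup>2 + 2 * (P * \<beta>) \<le> d\<^sup>2 + 2 * (Q * \<gamma>) + \<gamma>\<^sup>2 + R\<^sup>2"
    using 1 by (simp add: power2_sum algebra_simps)
  then have "2 * P * \<beta> - 2 * P * \<gamma> \<le> d\<^sup>2 + 2 * R\<^sup>2 + 2 * (d * R)"
    using sq(2) m zero_le_power2[of \<beta>] unfolding mult.assoc abs_le_iff by linarith
  moreover have "\<gamma>\<^sup>2 + 2 * (Q * \<gamma>) \<le> d\<^sup>2 + 2 * (P * \<beta>) + \<beta>\<^sup>2 + R\<^sup>2"
    using 2 by (simp add: power2_sum algebra_simps)
  then have "2 * P * \<gamma> - 2 * P * \<beta> \<le> d\<^sup>2 + 2 * R\<^sup>2 + 2 * (d * R)"
    using sq(1) m zero_le_power2[of \<gamma>] unfolding mult.assoc abs_le_iff by linarith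
  ultimately have "\<bar>2 * P * \<beta> - 2 * P * \<gamma>\<bar> \<le> d\<^sup>2 + 2 * R\<^sup>2 + 2 * (d * R)" by (simp add: abs_le_iff)
  moreover have "\<bar>2 * P * \<beta> - 2 * P * \<gamma>\<bar> = \<bar>\<beta> - \<gamma>\<bar> * (2 * P)"
  proof -
    have "2 * P * \<beta> - 2 * P * \<gamma> = (\<beta> - \<gamma>) * (2 * P)" by (simp add: algebra_simps)
    then show ?thesis using p by (simp add: abs_mult P_def)
  qed
  moreover have "d\<^sup>2 + 2 * R\<^sup>2 + 2 * (d * R) \<le> (d + 2 * R)\<^sup>2"
    by (simp add: power2_sum R_def d_def power_mult_distrib algebra_simps)
  ultimately have "\<bar>\<beta> - \<gamma>\<bar> * (2 * P) \<le> (d + 2 * R)\<^sup>2" by linarith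
  then have "\<bar>\<beta> - \<gamma>\<bar> \<le> (d + 2 * R)\<^sup>2 / (2 * P)" using p by (simp add: P_def pos_le_divide_eq)
  then show ?thesis by (simp add: P_def R_def d_def \<beta>_def \<gamma>_def)
qed

lemma tendsto_fun_iff:
  fixes f :: "'i \<Rightarrow> 'a \<Rightarrow> 'b::topological_space"
  shows "(f \<longlongrightarrow> l) F \<longleftrightarrow> (\<forall>i. ((\<lambda>x. f x i) \<longlongrightarrow> l i) F)"
  using limitin_componentwise[of "\<lambda>_. euclidean :: 'b topology" UNIV f l F]
  by (simp add: euclidean_product_topology)

text \<open>The product metric on real sequences is built from coordinate differences, so it is
  translation invariant and the distance of \<open>f i\<close> and \<open>g i\<close> is that of
  their difference to 0.\<close>

lemma tendsto_dist_fun_zeroI: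
  fixes f g :: "'i \<Rightarrow> nat \<Rightarrow> real"
  assumes "\<And>n. ((\<lambda>i. f i n - g i n) \<longlongrightarrow> 0) F"
  shows "((\<lambda>i. dist (f i) (g i)) \<longlongrightarrow> 0) F"
proof -
  have "((\<lambda>i n. f i n - g i n) \<longlongrightarrow> (\<lambda>_. 0)) F"
    using assms by (simp add: tendsto_fun_iff)
  then have "((\<lambda>i. dist (\<lambda>n. f i n - g i n) (\<lambda>_. 0)) \<longlongrightarrow> 0) F"
    by (rule iffD1[OF tendsto_dist_iff])
  then show ?thesis by (simp add: dist_fun_def dist_real_def)
qed

text \<open>The sequence enumerates finite nets of the balls of integer radius around
  \<open>x0\<close>, at all scales \<open>1 / (j + 1)\<close>.\<close>

lemma proper_metric_space_dense_sequence:
  assumes "proper_metric_space TYPE('x::metric_space)"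
  shows "\<exists>D :: nat \<Rightarrow> 'x. \<forall>y. \<forall>e>0. \<exists>n. dist (D n) y < e"
proof -
  fix x0 :: 'x
  have "\<exists>k. finite k \<and> k \<subseteq> cball x0 (real m) \<and> cball x0 (real m) \<subseteq> (\<Union>x\<in>k. ball x (1 / real (Suc j)))" for m j :: nat
    using assms seq_compact_imp_totally_bounded[of "cball x0 (real m)"]
    by (simp add: proper_metric_space_def compact_imp_seq_compact)
  then obtain K where K: "\<And>m j. finite (K m j)" "\<And>m j. cball x0 (real m) \<subseteq> (\<Union>x\<in>K m j. ball x (1 / real (Suc j)))"
    by metis
  define U where "U = insert x0 (\<Union>m j. K m j)"
  have U: "countable U" "U \<noteq> {}" using K(1) by (auto simp: U_def countable_finite)
  have "\<exists>n. dist (from_nat_into U n) y < e" if e: "e > 0" for y e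
  proof -
    obtain m :: nat where "dist x0 y \<le> real m" using real_arch_simple by blast
    moreover obtain j where j: "1 / real (Suc j) < e" using e nat_approx_posE by blast
    ultimately obtain x where "x \<in> K m j" "dist x y < 1 / real (Suc j)" using K(2)[of m j] by force
    then have "x \<in> U" "dist x y < e" using j by (auto simp: U_def)
    then show ?thesis using from_nat_into_surj[OF U(1)] by blast
  qed
  then show ?thesis by blast
qed

text \<open>This allows a compact space of sequences to be carried by a set of reals. The pair
  becomes one sequence, each real a set of naturals, and the sequence of sets is flattened to a
  single set by \<open>prod_encode\<close>.\<close>

lemma ex_inj_real_sequences: "\<exists>e :: (nat \<Rightarrow> real) \<times> real \<Rightarrow> real. inj e"
proof -
  obtain f :: "real \<Rightarrow> nat set" where f: "inj f"
    using nat_sets_eqpoll_reals by (metis bij_betw_def eqpoll_def eqpoll_sym)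
  obtain h :: "nat set \<Rightarrow> real" where h: "inj h"
    using nat_sets_eqpoll_reals by (metis bij_betw_def eqpoll_def)
  define c :: "(nat \<Rightarrow> real) \<times> real \<Rightarrow> nat \<Rightarrow> real" where "c p = (\<lambda>n. case n of 0 \<Rightarrow> snd p | Suc k \<Rightarrow> fst p k)" for p
  have c: "inj c"
  proof (rule injI)
    fix p q assume eq: "c p = c q"
    have "snd p = snd q" using fun_cong[OF eq, of 0] by (simp add: c_def)
    moreover have "fst p k = fst q k" for k using fun_cong[OF eq, of "Suc k"] by (simp add: c_def)
    ultimately show "p = q" by (simp add: prod_eq_iff fun_eq_iff)
  qed
  define d :: "(nat \<Rightarrow> real) \<Rightarrow> nat set" where "d v = prod_encode ` (SIGMA n:UNIV. f (v n))" for v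
  have "inj d"
  proof (rule injI)
    fix v w assume "d v = d w"
    then have "(SIGMA n:UNIV. f (v n)) = (SIGMA n:UNIV. f (w n))"
      by (simp add: d_def inj_image_eq_iff inj_prod_encode)
    then have "f (v n) = f (w n)" for n by blast
    then show "v = w" using f by (simp add: fun_eq_iff inj_eq)
  qed
  then have "inj (h \<circ> d \<circ> c)" using h c by (simp add: inj_compose)
  then show ?thesis by blast
qed

section \<open>Measurability for the Borel sets of a topology\<close>

lemma space_borel_on [simp]: "space (borel_on T) = topspace T"
  unfolding borel_on_def by (rule space_measure_of) (auto dest: openin_subset)

lemma openin_in_sets_borel_on: "openin T U \<Longrightarrow> U \<in> sets (borel_on T)"
  unfolding borel_on_def by (subst sets_measure_of) (auto dest: openin_subset)

lemma measurable_borel_on: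
  assumes "f \<in> space M \<rightarrow> topspace T" "\<And>U. openin T U \<Longrightarrow> f -` U \<inter> space M \<in> sets M"
  shows "f \<in> measurable M (borel_on T)"
  unfolding borel_on_def using assms by (intro measurable_measure_of) (auto dest: openin_subset)

lemma continuous_map_measurable_borel_on:
  assumes "continuous_map T T' f" and "sets M = sets (borel_on T)"
  shows "f \<in> measurable M (borel_on T')"
proof (rule measurable_borel_on)
  have sp: "space M = topspace T" using sets_eq_imp_space_eq[OF assms(2)] by simp
  show "f \<in> space M \<rightarrow> topspace T'" using assms(1) unfolding sp by (rule continuous_map_funspace)
  fix U assume "openin T' U"
  then have "openin T (f -` U \<inter> topspace T)" using assms(1) by (simp add: continuous_map_alt)
  then show "f -` U \<inter> space M \<in> sets M" unfolding sp assms(2) by (rule openin_in_sets_borel_on)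
qed

lemma continuous_map_borel_measurable:
  fixes f :: "'a \<Rightarrow> 'b::topological_space"
  assumes "continuous_map T euclidean f" and "sets M = sets (borel_on T)"
  shows "f \<in> borel_measurable M"
proof (rule borel_measurableI)
  have sp: "space M = topspace T" using sets_eq_imp_space_eq[OF assms(2)] by simp
  fix U :: "'b set" assume "open U"
  then have "openin T (f -` U \<inter> topspace T)" using assms(1) by (simp add: continuous_map_alt)
  then show "f -` U \<inter> space M \<in> sets M" unfolding sp assms(2) by (rule openin_in_sets_borel_on)
qed

text \<open>The condition \<open>ext\<close> reflects that \<open>BijGroup E\<close> consists of
  bijections that are extensional on \<open>E\<close>.\<close>

lemma group_actionI:
  fixes G (structure)
  assumes "group G"
    and ext: "\<And>g. g \<in> carrier G \<Longrightarrow> \<alpha> g \<in> extensional E"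
    and cl: "\<And>g x. \<lbrakk>g \<in> carrier G; x \<in> E\<rbrakk> \<Longrightarrow> \<alpha> g x \<in> E"
    and one: "\<And>x. x \<in> E \<Longrightarrow> \<alpha> \<one> x = x"
    and mult: "\<And>g h x. \<lbrakk>g \<in> carrier G; h \<in> carrier G; x \<in> E\<rbrakk> \<Longrightarrow> \<alpha> (g \<otimes> h) x = \<alpha> g (\<alpha> h x)"
  shows "group_action G E \<alpha>"
proof -
  interpret group G by fact
  have Bij: "\<alpha> g \<in> Bij E" if g: "g \<in> carrier G" for g
  proof -
    have "bij_betw (\<alpha> g) E E"
    proof (rule bij_betw_byWitness[where f' = "\<alpha> (inv g)"])
      show "\<forall>x\<in>E. \<alpha> (inv g) (\<alpha> g x) = x" "\<forall>x\<in>E. \<alpha> g (\<alpha> (inv g) x) = x"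
        using g by (simp_all add: mult[symmetric] one)
    qed (use g cl in auto)
    then show ?thesis using ext[OF g] by (simp add: Bij_def)
  qed
  have "\<alpha> \<in> hom G (BijGroup E)"
  proof (rule homI)
    show "\<alpha> g \<in> carrier (BijGroup E)" if "g \<in> carrier G" for g using Bij[OF that] by (simp add: BijGroup_def)
    fix g h assume gh: "g \<in> carrier G" "h \<in> carrier G"
    have "\<alpha> (g \<otimes> h) = compose E (\<alpha> g) (\<alpha> h)"
      by (rule extensionalityI[of _ E]) (use gh ext mult in \<open>auto simp: compose_def\<close>)
    then show "\<alpha> (g \<otimes> h) = \<alpha> g \<otimes>\<^bsub>BijGroup E\<^esub> \<alpha> h" using Bij gh by (simp add: BijGroup_def)
  qed
  then show ?thesis
    by (intro group_action.intro group_hom.intro group_hom_axioms.intro group_BijGroup is_group)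
qed

section \<open>The compactification\<close>

text \<open>\<open>D\<close> is a dense sequence, which records a horofunction as a real sequence; \<open>code\<close> transports the
  resulting compact subset of a metrizable space to a subset of the reals.\<close>

locale coded_isometric_action =
  fixes G :: "('g, 'b) monoid_scheme" (structure) and \<phi> :: "'g \<Rightarrow> 'x::metric_space \<Rightarrow> 'x"
    and x0 :: 'x and D :: "nat \<Rightarrow> 'x" and code :: "(nat \<Rightarrow> real) \<times> real \<Rightarrow> real"
  assumes is_group: "group G" and isometric: "isometric_action G \<phi>"
    and dense: "\<And>y e. e > 0 \<Longrightarrow> \<exists>n. dist (D n) y < e"
    and inj_code: "inj code"
begin

sublocale group G by (rule is_group)

sublocale \<phi>: group_action G UNIV \<phi>
  using isometric by (simp add: isometric_action_def)

lemma phi_mult: "\<lbrakk>g \<in> carrier G; h \<in> carrier G\<rbrakk> \<Longrightarrow> \<phi> (g \<otimes> h) x = \<phi> g (\<phi> h x)"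
  using \<phi>.composition_rule[of x g h] by simp

lemma phi_one: "\<phi> \<one> x = x"
  using fun_cong[OF \<phi>.id_eq_one, of x] by simp

lemma phi_phi_inv: "g \<in> carrier G \<Longrightarrow> \<phi> g (\<phi> (inv g) x) = x"
  using phi_mult[of g "inv g" x] by (simp add: phi_one)

lemma dist_phi: "g \<in> carrier G \<Longrightarrow> dist (\<phi> g x) (\<phi> g y) = dist x y"
  using isometric by (simp add: isometric_action_def isometry_of_def)

lemma dist_phi_inv: "g \<in> carrier G \<Longrightarrow> dist (\<phi> g x) y = dist x (\<phi> (inv g) y)"
  using dist_phi[of g x "\<phi> (inv g) y"] by (simp add: phi_phi_inv)

section \<open>Horofunctions encoded as real sequences\<close>

definition coords :: "'x \<Rightarrow> nat \<Rightarrow> real" where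
  "coords z = (\<lambda>n. dist z (D n) - dist z x0)"

text \<open>This models the horofunction compactification of the space as a closed subset of a
  countable product of lines.\<close>

definition horo_coords :: "(nat \<Rightarrow> real) set" where
  "horo_coords = closure (range coords)"

definition is_horofunction :: "('x \<Rightarrow> real) \<Rightarrow> bool" where
  "is_horofunction b \<longleftrightarrow> (\<exists>z. horofunction x0 z b)"

lemma is_horofunction_abs_le_dist: "is_horofunction b \<Longrightarrow> \<bar>b y - b y'\<bar> \<le> dist y y'"
  unfolding is_horofunction_def using horofunction_abs_le_dist by blast

lemma is_horofunction_point: "is_horofunction (\<lambda>y. dist z y - dist z x0)"
  unfolding is_horofunction_def horofunction_def by (intro exI[of _ "\<lambda>_. z"]) simp

lemma horofunction_eqI:
  assumes b: "is_horofunction b" "is_horofunction b'" and eq: "\<And>n. b (D n) = b' (D n)"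
  shows "b = b'"
proof
  fix y
  have "\<bar>b y - b' y\<bar> \<le> 0 + e" if e: "e > 0" for e
  proof -
    obtain n where n: "dist (D n) y < e / 2" using dense[of "e / 2"] e by auto
    then show ?thesis
      using is_horofunction_abs_le_dist[OF b(1), of "D n" y] is_horofunction_abs_le_dist[OF b(2), of "D n" y] eq[of n]
      by linarith
  qed
  then have "\<bar>b y - b' y\<bar> \<le> 0" by (rule field_le_epsilon)
  then show "b y = b' y" by simp
qed

lemma horofunction_coords:
  assumes "is_horofunction b" shows "(\<lambda>n. b (D n)) \<in> horo_coords"
proof -
  obtain z where z: "horofunction x0 z b" using assms by (auto simp: is_horofunction_def)
  have "(\<lambda>k. coords (z k)) \<longlonglongrightarrow> (\<lambda>n. b (D n))"
    unfolding tendsto_fun_iff coords_def using horofunction_tendsto[OF z] by blast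
  then show ?thesis unfolding horo_coords_def closure_sequential by (intro exI[of _ "\<lambda>k. coords (z k)"]) simp
qed

text \<open>Normalised distance functions are 1-Lipschitz, so convergence at the dense points
  \<open>D n\<close> gives a Cauchy sequence at every point; the pointwise limit is the
  horofunction.\<close>

lemma ex_horofunction:
  assumes v: "v \<in> horo_coords" shows "\<exists>b. is_horofunction b \<and> (\<forall>n. b (D n) = v n)"
proof -
  from v[unfolded horo_coords_def closure_sequential]
  obtain f where f: "\<forall>k. f k \<in> range coords" "f \<longlonglongrightarrow> v" by (elim exE conjE)
  have "\<forall>k. \<exists>x. f k = coords x" using f(1) by (simp add: image_iff)
  then obtain z where "\<And>k. f k = coords (z k)" by (auto dest!: choice)
  then have z: "(\<lambda>k. coords (z k) n) \<longlonglongrightarrow> v n" for n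
    using f(2) by (simp add: tendsto_fun_iff)
  define h where "h k y = dist (z k) y - dist (z k) x0" for k y
  have lip: "\<bar>h k y - h k y'\<bar> \<le> dist y y'" for k y y'
    using abs_dist_diff_le[of y "z k" y'] by (simp add: h_def dist_commute)
  have "convergent (\<lambda>k. h k y)" for y
  proof (rule real_Cauchy_convergent, rule metric_CauchyI)
    fix e :: real assume e: "e > 0"
    obtain n where n: "dist (D n) y < e / 3" using dense[of "e / 3"] e by auto
    have "Cauchy (\<lambda>k. h k (D n))"
      using z[of n] unfolding coords_def h_def by (rule LIMSEQ_imp_Cauchy)
    then obtain N where N: "\<And>k m. \<lbrakk>k \<ge> N; m \<ge> N\<rbrakk> \<Longrightarrow> dist (h k (D n)) (h m (D n)) < e / 3"
      using e metric_CauchyD[of "\<lambda>k. h k (D n)" "e / 3"] by auto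
    have "dist (h k y) (h m y) < e" if "k \<ge> N" "m \<ge> N" for k m
      using N[OF that] lip[of k "D n" y] lip[of m "D n" y] n unfolding dist_real_def by linarith
    then show "\<exists>N. \<forall>m\<ge>N. \<forall>k\<ge>N. dist (h m y) (h k y) < e" by blast
  qed
  then have lim: "(\<lambda>k. h k y) \<longlonglongrightarrow> lim (\<lambda>k. h k y)" for y by (simp add: convergent_LIMSEQ_iff)
  show ?thesis
  proof (intro exI[of _ "\<lambda>y. lim (\<lambda>k. h k y)"] conjI allI)
    show "is_horofunction (\<lambda>y. lim (\<lambda>k. h k y))"
      unfolding is_horofunction_def horofunction_def using lim by (auto simp: h_def)
    show "lim (\<lambda>k. h k (D n)) = v n" for n
      using LIMSEQ_unique[OF lim[of "D n"]] z[of n] by (simp add: coords_def h_def)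
  qed
qed

text \<open>By \<open>horofunction_eqI\<close> the choice is unique for \<open>v\<close> in
  \<open>horo_coords\<close>, where \<open>horo_ext\<close> inverts sampling at
  \<open>D\<close>.\<close>

definition horo_ext :: "(nat \<Rightarrow> real) \<Rightarrow> 'x \<Rightarrow> real" where
  "horo_ext v = (SOME b. is_horofunction b \<and> (\<forall>n. b (D n) = v n))"

lemma horo_ext:
  assumes "v \<in> horo_coords"
  shows "is_horofunction (horo_ext v)" "horo_ext v (D n) = v n"
  using someI_ex[OF ex_horofunction[OF assms]] unfolding horo_ext_def by blast+

lemma horo_ext_eqI:
  assumes "is_horofunction b" shows "horo_ext (\<lambda>n. b (D n)) = b"
  using horo_ext[OF horofunction_coords[OF assms]] assms by (intro horofunction_eqI) auto

lemma coords_in: "coords z \<in> horo_coords"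
  unfolding horo_coords_def by (rule subsetD[OF closure_subset]) simp

lemma horo_ext_coords: "horo_ext (coords z) = (\<lambda>y. dist z y - dist z x0)"
  using horo_ext_eqI[OF is_horofunction_point[of z]] by (simp add: coords_def)

lemma horo_ext_base: "v \<in> horo_coords \<Longrightarrow> horo_ext v x0 = 0"
  using horo_ext(1)[of v] horofunction_base by (auto simp: is_horofunction_def)

text \<open>The triangle inequality bounds coordinate \<open>n\<close> by
  \<open>dist (D n) x0\<close>, so Tychonoff's theorem applies to a product of intervals.\<close>

lemma compact_horo_coords: "compact horo_coords"
proof -
  define B where "B = (\<Pi>\<^sub>E n\<in>UNIV. {- dist (D n) x0..dist (D n) x0})"
  have "compactin (product_topology (\<lambda>_. euclidean) UNIV) B"
    unfolding B_def by (subst compactin_PiE) simp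
  then have B: "compact B" by (simp add: euclidean_product_topology)
  have "coords z n \<in> {- dist (D n) x0..dist (D n) x0}" for z n
    using abs_dist_diff_le[of "D n" z x0] by (simp add: coords_def dist_commute abs_le_iff)
  then have "range coords \<subseteq> B" by (auto simp: B_def)
  then have "horo_coords \<subseteq> B"
    unfolding horo_coords_def using B by (intro closure_minimal compact_imp_closed)
  then have "horo_coords = B \<inter> horo_coords" by blast
  moreover have "compact (B \<inter> horo_coords)"
    using B by (intro compact_Int_closed) (simp_all add: horo_coords_def)
  ultimately show ?thesis by simp
qed

text \<open>Evaluation at \<open>y\<close> differs from the coordinate \<open>n\<close> by at most
  \<open>dist (D n) y\<close>, uniformly in \<open>v\<close>.\<close>

lemma continuous_on_horo_ext: "continuous_on horo_coords (\<lambda>v. horo_ext v y)"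
  unfolding continuous_on_def
proof (intro ballI tendstoI)
  fix v and e :: real assume v: "v \<in> horo_coords" and e: "e > 0"
  obtain n where n: "dist (D n) y < e / 3" using dense[of "e / 3"] e by auto
  have "((\<lambda>w. w n) \<longlongrightarrow> v n) (at v within horo_coords)"
    using tendsto_ident_at[of v horo_coords] by (simp add: tendsto_fun_iff)
  then have "\<forall>\<^sub>F w in at v within horo_coords. dist (w n) (v n) < e / 3" using e by (intro tendstoD) auto
  moreover have "\<forall>\<^sub>F w in at v within horo_coords. w \<in> horo_coords"
    unfolding eventually_at_topological by (intro exI[of _ UNIV]) simp
  ultimately show "\<forall>\<^sub>F w in at v within horo_coords. dist (horo_ext w y) (horo_ext v y) < e"
  proof eventually_elim
    case (elim w)
    have "\<bar>horo_ext w (D n) - horo_ext w y\<bar> \<le> dist (D n) y" "\<bar>horo_ext v (D n) - horo_ext v y\<bar> \<le> dist (D n) y"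
      using horo_ext(1) elim(2) v is_horofunction_abs_le_dist by blast+
    then show ?case using n elim v unfolding dist_real_def horo_ext(2)[OF v] horo_ext(2)[OF elim(2)] by linarith
  qed
qed

section \<open>The action on horofunctions\<close>

definition translate :: "'g \<Rightarrow> ('x \<Rightarrow> real) \<Rightarrow> 'x \<Rightarrow> real" where
  "translate g b = (\<lambda>y. b (\<phi> (inv g) y) - b (\<phi> (inv g) x0))"

text \<open>If \<open>b\<close> arises from the points \<open>z n\<close>, its translate arises from
  \<open>\<phi> g (z n)\<close>; subtracting the value at the preimage of \<open>x0\<close> restores
  the normalisation.\<close>

lemma is_horofunction_translate:
  assumes g: "g \<in> carrier G" and b: "is_horofunction b"
  shows "is_horofunction (translate g b)"
proof -
  obtain z where z: "horofunction x0 z b" using b by (auto simp: is_horofunction_def)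
  have "horofunction x0 (\<lambda>n. \<phi> g (z n)) (translate g b)"
    unfolding horofunction_def translate_def
  proof
    fix y
    show "(\<lambda>n. dist (\<phi> g (z n)) y - dist (\<phi> g (z n)) x0) \<longlonglongrightarrow> b (\<phi> (inv g) y) - b (\<phi> (inv g) x0)"
      using tendsto_diff[OF horofunction_tendsto[OF z, of "\<phi> (inv g) y"] horofunction_tendsto[OF z, of "\<phi> (inv g) x0"]] g
      by (simp add: dist_phi_inv)
  qed
  then show ?thesis by (auto simp: is_horofunction_def)
qed

definition shift :: "'g \<Rightarrow> (nat \<Rightarrow> real) \<Rightarrow> nat \<Rightarrow> real" where
  "shift g v = (\<lambda>n. translate g (horo_ext v) (D n))"

lemma shift_in: "\<lbrakk>g \<in> carrier G; v \<in> horo_coords\<rbrakk> \<Longrightarrow> shift g v \<in> horo_coords"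
  unfolding shift_def by (intro horofunction_coords is_horofunction_translate horo_ext)

lemma horo_ext_shift:
  "\<lbrakk>g \<in> carrier G; v \<in> horo_coords\<rbrakk> \<Longrightarrow> horo_ext (shift g v) = translate g (horo_ext v)"
  unfolding shift_def by (intro horo_ext_eqI is_horofunction_translate horo_ext)

lemma shift_one: "v \<in> horo_coords \<Longrightarrow> shift \<one> v = v"
  by (simp add: shift_def translate_def phi_one horo_ext(2) horo_ext_base)

lemma shift_mult:
  assumes "g \<in> carrier G" "h \<in> carrier G" "v \<in> horo_coords"
  shows "shift (g \<otimes> h) v = shift g (shift h v)"
  using assms unfolding shift_def[of g] shift_def[of "g \<otimes> h"] horo_ext_shift[OF assms(2,3)]
  by (simp add: translate_def inv_mult_group phi_mult)

lemma shift_coords: "g \<in> carrier G \<Longrightarrow> shift g (coords z) = coords (\<phi> g z)"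
  unfolding shift_def horo_ext_coords by (simp add: translate_def coords_def dist_phi_inv)

lemma continuous_on_shift: "continuous_on horo_coords (shift g)"
  unfolding shift_def translate_def
  by (intro continuous_on_coordinatewise_then_product continuous_on_diff continuous_on_horo_ext)

section \<open>The compact space \<open>K\<close>, its action and its diffuse measure\<close>

definition model :: "((nat \<Rightarrow> real) \<times> real) set" where
  "model = horo_coords \<times> {0..1}"

definition decode :: "real \<Rightarrow> (nat \<Rightarrow> real) \<times> real" where
  "decode = inv_into UNIV code"

text \<open>The topology is that of \<open>model\<close> transported so that \<open>code\<close>
  becomes a homeomorphism; it is unrelated to the usual topology of the reals.\<close>

definition K :: "real topology" where
  "K = pullback_topology (code ` model) decode (top_of_set model)"

text \<open>The restricted abstraction makes \<open>\<alpha> g\<close> extensional on the carrier of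
  \<open>K\<close>, as \<open>group_action\<close> demands.\<close>

definition \<alpha> :: "'g \<Rightarrow> real \<Rightarrow> real" where
  "\<alpha> g = (\<lambda>\<kappa>\<in>code ` model. code (shift g (fst (decode \<kappa>)), snd (decode \<kappa>)))"

definition \<eta> :: "real measure" where
  "\<eta> = distr (restrict_space lborel {0..1}) (borel_on K) (\<lambda>t. code (coords x0, t))"

lemma decode_code [simp]: "decode (code p) = p"
  unfolding decode_def using inj_code by simp

lemma compact_model: "compact model"
  unfolding model_def by (intro compact_Times compact_horo_coords) simp

lemma topspace_K: "topspace K = code ` model"
  unfolding K_def topspace_pullback_topology by auto

lemma continuous_map_decode: "continuous_map K (top_of_set model) decode"
proof -
  have "continuous_map K (top_of_set model) (id \<circ> decode)"
    unfolding K_def by (rule continuous_map_pullback) simp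
  then show ?thesis by simp
qed

lemma continuous_map_code: "continuous_map (top_of_set model) K code"
  unfolding K_def by (rule continuous_map_pullback') (auto simp: o_def)

lemma homeomorphic_K: "K homeomorphic_space top_of_set model"
  unfolding homeomorphic_space_def homeomorphic_maps_def
  using continuous_map_decode continuous_map_code by (intro exI[of _ decode] exI[of _ code]) (auto simp: topspace_K)

lemma compact_K: "compact_space K"
  using homeomorphic_compact_space[OF homeomorphic_K] compact_model
  by (simp add: compact_space_subtopology)

lemma metrizable_K: "metrizable_space K"
  using homeomorphic_metrizable_space[OF homeomorphic_K]
  by (simp add: metrizable_space_subtopology metrizable_space_euclidean)

lemma \<alpha>_code: "p \<in> model \<Longrightarrow> \<alpha> g (code p) = code (shift g (fst p), snd p)"
  by (simp add: \<alpha>_def)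

lemma shift_model: "\<lbrakk>g \<in> carrier G; p \<in> model\<rbrakk> \<Longrightarrow> (shift g (fst p), snd p) \<in> model"
  using shift_in by (auto simp: model_def)

lemma continuous_map_\<alpha>:
  assumes g: "g \<in> carrier G" shows "continuous_map K K (\<alpha> g)"
proof -
  have "continuous_on model (\<lambda>p. (shift g (fst p), snd p))"
    by (intro continuous_on_Pair continuous_on_compose2[OF continuous_on_shift] continuous_on_fst
        continuous_on_snd continuous_on_id) (auto simp: model_def)
  then have "continuous_map (top_of_set model) (top_of_set model) (\<lambda>p. (shift g (fst p), snd p))"
    using shift_model[OF g] by (auto simp: continuous_map_in_subtopology)
  then have "continuous_map K K (code \<circ> (\<lambda>p. (shift g (fst p), snd p)) \<circ> decode)"
    by (intro continuous_map_compose[OF continuous_map_decode] continuous_map_compose[OF _ continuous_map_code])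
  then show ?thesis
    by (rule continuous_map_eq) (auto simp: topspace_K \<alpha>_code)
qed

lemma group_action_\<alpha>: "group_action G (topspace K) \<alpha>"
proof (rule group_actionI[OF is_group])
  show "\<alpha> g \<in> extensional (topspace K)" for g by (simp add: \<alpha>_def topspace_K)
  show "\<alpha> g x \<in> topspace K" if "g \<in> carrier G" "x \<in> topspace K" for g x
    using continuous_map_\<alpha>[OF that(1)] that(2) continuous_map_image_subset_topspace by blast
  show "\<alpha> \<one> x = x" if "x \<in> topspace K" for x
    using that by (auto simp: topspace_K \<alpha>_code model_def shift_one)
  show "\<alpha> (g \<otimes> h) x = \<alpha> g (\<alpha> h x)" if "g \<in> carrier G" "h \<in> carrier G" "x \<in> topspace K" for g h x
    using that shift_model[OF that(2)] by (auto simp: topspace_K \<alpha>_code) (auto simp: model_def shift_mult)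
qed

lemma G_space_K: "G_space G K \<alpha>"
proof -
  interpret \<alpha>: group_action G "topspace K" \<alpha> by (rule group_action_\<alpha>)
  have "homeomorphic_maps K K (\<alpha> g) (\<alpha> (inv g))" if g: "g \<in> carrier G" for g
    unfolding homeomorphic_maps_def
  proof (intro conjI ballI)
    show "\<alpha> (inv g) (\<alpha> g x) = x" if "x \<in> topspace K" for x using \<alpha>.orbit_sym_aux[OF g that] by simp
    show "\<alpha> g (\<alpha> (inv g) x) = x" if "x \<in> topspace K" for x
      using \<alpha>.orbit_sym_aux[OF inv_closed[OF g] that] g by simp
  qed (use g continuous_map_\<alpha> in auto)
  then show ?thesis unfolding G_space_def using group_action_\<alpha> homeomorphic_map_maps by blast
qed

lemma code_segment_measurable:
  assumes "v \<in> horo_coords"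
  shows "(\<lambda>t. code (v, t)) \<in> measurable (restrict_space lborel {0..1}) (borel_on K)"
proof (rule measurable_borel_on)
  have "continuous_map (top_of_set {0..1}) (top_of_set model) (\<lambda>t. (v, t))"
    using assms by (auto simp: continuous_map_in_subtopology model_def intro!: continuous_intros)
  then have "continuous_map (top_of_set {0..1}) K (code \<circ> (\<lambda>t. (v, t)))"
    by (rule continuous_map_compose[OF _ continuous_map_code])
  then have cont: "continuous_map (top_of_set {0..1}) K (\<lambda>t. code (v, t))" by (simp add: o_def)
  from continuous_map_funspace[OF this]
  show "(\<lambda>t. code (v, t)) \<in> space (restrict_space lborel {0..1}) \<rightarrow> topspace K"
    by (simp add: space_restrict_space)
  fix U assume "openin K U"
  with cont have "openin (top_of_set {0..1}) ((\<lambda>t. code (v, t)) -` U \<inter> {0..1})"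
    by (simp add: continuous_map_alt)
  then obtain V where "open V" "(\<lambda>t. code (v, t)) -` U \<inter> {0..1} = {0..1} \<inter> V"
    by (auto simp: openin_open)
  then show "(\<lambda>t. code (v, t)) -` U \<inter> space (restrict_space lborel {0..1}) \<in> sets (restrict_space lborel {0..1})"
    by (auto simp: space_restrict_space sets_restrict_space)
qed

lemma prob_space_unit: "prob_space (restrict_space lborel {0..1::real})"
  by (rule prob_space_restrict_space) auto

lemma borel_probability_\<eta>: "borel_probability K \<eta>"
  unfolding borel_probability_def \<eta>_def
  using prob_space.prob_space_distr[OF prob_space_unit code_segment_measurable[OF coords_in[of x0]]] by simp

text \<open>Singletons are closed in the Hausdorff space \<open>K\<close>, hence Borel, and the
  preimage of one in the unit interval has at most one element.\<close>

lemma diffuse_\<eta>: "diffuse K \<eta>"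
  unfolding diffuse_def
proof
  fix \<kappa> assume \<kappa>: "\<kappa> \<in> topspace K"
  let ?A = "(\<lambda>t. code (coords x0, t)) -` {\<kappa>} \<inter> {0..1}"
  have "Hausdorff_space K" by (rule metrizable_imp_Hausdorff_space[OF metrizable_K])
  then have "closedin K {\<kappa>}" using \<kappa> by (simp add: closedin_Hausdorff_singleton)
  then have "topspace K - (topspace K - {\<kappa>}) \<in> sets (borel_on K)"
    using sets.compl_sets[OF openin_in_sets_borel_on, of K "topspace K - {\<kappa>}"] by (simp add: closedin_def)
  moreover have "topspace K - (topspace K - {\<kappa>}) = {\<kappa>}" using \<kappa> by blast
  ultimately have meas: "{\<kappa>} \<in> sets (borel_on K)" by simp
  have "?A \<subseteq> {snd (decode \<kappa>)}" by auto
  then have "emeasure lborel ?A = 0"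
    by (intro emeasure_lborel_countable) (meson countable_finite finite.emptyI finite.insertI finite_subset)
  then show "emeasure \<eta> {\<kappa>} = 0"
    unfolding \<eta>_def
    by (subst emeasure_distr[OF code_segment_measurable[OF coords_in] meas])
      (simp add: space_restrict_space emeasure_restrict_space)
qed

section \<open>No invariant probability on \<open>K\<close>, and asymptotic invariance of
  \<open>\<eta>\<close>\<close>

lemma continuous_map_horo_ext_K: "continuous_map K euclideanreal (\<lambda>\<kappa>. horo_ext (fst (decode \<kappa>)) y)"
proof -
  have "continuous_on model (\<lambda>p. horo_ext (fst p) y)"
    by (intro continuous_on_compose2[OF continuous_on_horo_ext] continuous_on_fst continuous_on_id)
      (auto simp: model_def)
  then have "continuous_map (top_of_set model) euclideanreal (\<lambda>p. horo_ext (fst p) y)" by simp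
  from continuous_map_compose[OF continuous_map_decode this] show ?thesis by (simp add: o_def)
qed

lemma no_invariant_probability_K:
  assumes X: "CAT0_space TYPE('x)" "proper_metric_space TYPE('x)" and ne: "nonelementary_action G \<phi>"
    and k: "k \<in> carrier G" "rank_one_isometry (\<phi> k)"
  shows "\<not> has_invariant_probability G K \<alpha>"
proof
  assume "has_invariant_probability G K \<alpha>"
  then obtain \<mu> where \<mu>: "prob_space \<mu>" "space \<mu> = topspace K" "sets \<mu> = sets (borel_on K)"
    and inv: "\<And>g. g \<in> carrier G \<Longrightarrow> push K \<alpha> g \<mu> = \<mu>"
    unfolding has_invariant_probability_def borel_probability_def by blast
  have in_model: "\<exists>p\<in>model. \<kappa> = code p" if "\<kappa> \<in> space \<mu>" for \<kappa> using that \<mu>(2) topspace_K by auto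
  show False
  proof (rule no_invariant_horofunction_measure[OF X is_group isometric ne k \<mu>(1),
        where H = "\<lambda>\<kappa>. horo_ext (fst (decode \<kappa>))" and A = \<alpha> and ?x0.0 = x0])
    show "(\<lambda>\<kappa>. horo_ext (fst (decode \<kappa>)) y) \<in> borel_measurable \<mu>" for y
      by (rule continuous_map_borel_measurable[OF continuous_map_horo_ext_K \<mu>(3)])
    show "\<exists>z. horofunction x0 z (horo_ext (fst (decode \<kappa>)))" if "\<kappa> \<in> space \<mu>" for \<kappa>
      using in_model[OF that] horo_ext(1) by (auto simp: is_horofunction_def model_def)
    fix g assume g: "g \<in> carrier G"
    have "\<alpha> g \<in> measurable \<mu> (borel_on K)"
      by (rule continuous_map_measurable_borel_on[OF continuous_map_\<alpha>[OF g] \<mu>(3)])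
    then show "\<alpha> g \<in> measurable \<mu> \<mu>" by (simp cong: measurable_cong_sets add: \<mu>(3))
    have "distr \<mu> \<mu> (\<alpha> g) = distr \<mu> (borel_on K) (\<alpha> g)" by (rule distr_cong) (simp_all add: \<mu>(3))
    then show "distr \<mu> \<mu> (\<alpha> g) = \<mu>" using inv[OF g] by (simp add: push_def)
    fix \<kappa> y assume "\<kappa> \<in> space \<mu>"
    then obtain v t where p: "(v, t) \<in> model" "\<kappa> = code (v, t)" using in_model by force
    then have "v \<in> horo_coords" by (simp add: model_def)
    then show "horo_ext (fst (decode (\<alpha> g \<kappa>))) y =
        horo_ext (fst (decode \<kappa>)) (\<phi> (inv g) y) - horo_ext (fst (decode \<kappa>)) (\<phi> (inv g) x0)"
      using p g by (simp add: \<alpha>_code horo_ext_shift translate_def)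
  qed
qed

text \<open>The action sends \<open>coords x0\<close> to \<open>coords (\<phi> g x0)\<close> and
  fixes the interval coordinate, so \<open>\<eta>\<close> is moved to Lebesgue measure on the
  segment over the orbit point.\<close>

lemma integral_push_\<eta>:
  assumes g: "g \<in> carrier G" and f: "continuous_map K euclideanreal f"
  shows "integral\<^sup>L (push K \<alpha> g \<eta>) f = (\<integral>t. f (code (coords (\<phi> g x0), t)) \<partial>restrict_space lborel {0..1})"
proof -
  have \<eta>: "sets \<eta> = sets (borel_on K)" by (simp add: \<eta>_def)
  have \<alpha>: "\<alpha> g \<in> measurable \<eta> (borel_on K)" and fm: "f \<in> borel_measurable (borel_on K)"
    by (rule continuous_map_measurable_borel_on[OF continuous_map_\<alpha>[OF g] \<eta>])
      (rule continuous_map_borel_measurable[OF f refl])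
  have "integral\<^sup>L (push K \<alpha> g \<eta>) f = (\<integral>\<kappa>. f (\<alpha> g \<kappa>) \<partial>\<eta>)"
    unfolding push_def by (rule integral_distr[OF \<alpha> fm])
  also have "\<dots> = (\<integral>t. f (\<alpha> g (code (coords x0, t))) \<partial>restrict_space lborel {0..1})"
    unfolding \<eta>_def
    by (rule integral_distr[OF code_segment_measurable[OF coords_in]])
      (use measurable_compose[OF \<alpha> fm] in \<open>simp add: \<eta>_def\<close>)
  also have "\<dots> = (\<integral>t. f (code (coords (\<phi> g x0), t)) \<partial>restrict_space lborel {0..1})"
    by (rule Bochner_Integration.integral_cong)
      (simp_all add: space_restrict_space \<alpha>_code model_def coords_in shift_coords g)
  finally show ?thesis .
qed

text \<open>In each coordinate the estimate \<open>CAT0_horofunction_near\<close> has a bounded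
  numerator and a denominator tending to infinity.\<close>

lemma dist_coords_tendsto_0:
  assumes X: "CAT0_space TYPE('x)" and p: "filterlim (\<lambda>i. dist (p i) x0) at_top F"
    and pq: "\<forall>\<^sub>F i in F. dist (p i) (q i) \<le> c"
  shows "((\<lambda>i. dist (coords (p i)) (coords (q i))) \<longlongrightarrow> 0) F"
proof (rule tendsto_dist_fun_zeroI)
  fix n
  let ?C = "(c + 2 * dist (D n) x0)\<^sup>2 / 2"
  show "((\<lambda>i. coords (p i) n - coords (q i) n) \<longlongrightarrow> 0) F"
  proof (rule Lim_null_comparison)
    show "((\<lambda>i. ?C / dist (p i) x0) \<longlongrightarrow> 0) F"
      by (rule tendsto_divide_0[OF tendsto_const filterlim_at_top_imp_at_infinity[OF p]])
    have "\<forall>\<^sub>F i in F. dist (p i) x0 > 0"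
      using p unfolding filterlim_at_top_dense by (rule spec)
    then show "\<forall>\<^sub>F i in F. norm (coords (p i) n - coords (q i) n) \<le> ?C / dist (p i) x0"
      using pq
    proof eventually_elim
      case (elim i)
      have "norm (coords (p i) n - coords (q i) n) \<le> (dist (p i) (q i) + 2 * dist (D n) x0)\<^sup>2 / (2 * dist (p i) x0)"
        using CAT0_horofunction_near[OF X elim(1), of "D n" "q i"] by (simp add: coords_def)
      also have "\<dots> \<le> (c + 2 * dist (D n) x0)\<^sup>2 / (2 * dist (p i) x0)"
        using elim by (intro divide_right_mono power_mono) auto
      finally show ?case by simp
    qed
  qed
qed

text \<open>Uniform continuity on the compact \<open>model\<close> turns closeness of the two base
  sequences into closeness of the integrands, uniformly on the interval. The filter is arbitrary, so
  that both sequences and ultrafilters are covered.\<close>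

lemma weak_star_diff_push_\<eta>:
  assumes X: "CAT0_space TYPE('x)" and u: "\<forall>\<^sub>F i in F. u i \<in> carrier G"
    and escape: "filterlim (\<lambda>i. dist (\<phi> (u i) x0) x0) at_top F" and h: "h \<in> carrier G"
  shows "weak_star_diff_to_zero K (\<lambda>i. push K \<alpha> (u i \<otimes> h) \<eta>) (\<lambda>i. push K \<alpha> (u i) \<eta>) F"
  unfolding weak_star_diff_to_zero_def
proof (intro allI impI tendstoI)
  fix f and e :: real assume f: "continuous_map K euclideanreal f" and e: "e > 0"
  let ?N = "restrict_space lborel {0..1::real}"
  interpret N: prob_space ?N by (rule prob_space_unit)
  have "continuous_map (top_of_set model) euclideanreal (f \<circ> code)"
    by (rule continuous_map_compose[OF continuous_map_code f])
  then have cont: "continuous_on model (\<lambda>p. f (code p))" by (simp add: o_def)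
  then have "uniformly_continuous_on model (\<lambda>p. f (code p))"
    by (rule compact_uniformly_continuous[OF _ compact_model])
  then obtain d where d: "d > 0"
    "\<And>p q. \<lbrakk>p \<in> model; q \<in> model; dist q p < d\<rbrakk> \<Longrightarrow> dist (f (code q)) (f (code p)) < e / 2"
    using e unfolding uniformly_continuous_on_def by (metis half_gt_zero)
  have "bounded ((\<lambda>p. f (code p)) ` model)"
    using compact_continuous_image[OF cont compact_model] by (rule compact_imp_bounded)
  then obtain B where B: "\<And>p. p \<in> model \<Longrightarrow> \<bar>f (code p)\<bar> \<le> B" by (auto simp: bounded_iff)
  have int: "integrable ?N (\<lambda>t. f (code (coords z, t)))" for z
  proof (rule N.integrable_const_bound[of _ B])
    show "AE t in ?N. norm (f (code (coords z, t))) \<le> B"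
      using B by (intro AE_I2) (simp add: space_restrict_space model_def coords_in)
    show "(\<lambda>t. f (code (coords z, t))) \<in> borel_measurable ?N"
      by (rule measurable_compose[OF code_segment_measurable[OF coords_in] continuous_map_borel_measurable[OF f refl]])
  qed
  have "((\<lambda>i. dist (coords (\<phi> (u i) x0)) (coords (\<phi> (u i \<otimes> h) x0))) \<longlongrightarrow> 0) F"
  proof (rule dist_coords_tendsto_0[OF X escape])
    show "\<forall>\<^sub>F i in F. dist (\<phi> (u i) x0) (\<phi> (u i \<otimes> h) x0) \<le> dist x0 (\<phi> h x0)"
      using u by eventually_elim (simp add: phi_mult h dist_phi)
  qed
  then have "\<forall>\<^sub>F i in F. dist (coords (\<phi> (u i) x0)) (coords (\<phi> (u i \<otimes> h) x0)) < d"
    using d(1) by (rule order_tendstoD)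
  then show "\<forall>\<^sub>F i in F. dist (integral\<^sup>L (push K \<alpha> (u i \<otimes> h) \<eta>) f - integral\<^sup>L (push K \<alpha> (u i) \<eta>) f) 0 < e"
    using u
  proof eventually_elim
    case (elim i)
    let ?p = "coords (\<phi> (u i \<otimes> h) x0)" and ?q = "coords (\<phi> (u i) x0)"
    let ?k = "\<lambda>t. f (code (?p, t)) - f (code (?q, t))"
    have k: "?k t \<le> e / 2" "- (e / 2) \<le> ?k t" if "t \<in> {0..1}" for t
    proof -
      have "dist (?p, t) (?q, t) < d" using elim(1) by (simp add: dist_Pair_Pair dist_commute)
      then have "dist (f (code (?p, t))) (f (code (?q, t))) < e / 2"
        using that by (intro d(2)) (simp_all add: model_def coords_in)
      then show "?k t \<le> e / 2" "- (e / 2) \<le> ?k t" unfolding dist_real_def by linarith+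
    qed
    have k_int: "integrable ?N ?k" by (intro Bochner_Integration.integrable_diff int)
    have "integral\<^sup>L ?N ?k \<le> e / 2"
      by (rule N.integral_le_const[OF k_int], rule AE_I2)
        (rule k(1), simp add: space_restrict_space)
    moreover have "- (e / 2) \<le> integral\<^sup>L ?N ?k"
      by (rule N.integral_ge_const[OF k_int], rule AE_I2)
        (rule k(2), simp add: space_restrict_space)
    ultimately have "\<bar>integral\<^sup>L ?N ?k\<bar> \<le> e / 2" by (simp add: abs_le_iff)
    then show ?case
      using e int elim h by (simp add: integral_push_\<eta> f)
  qed
qed

end

section \<open>Escape to infinity and the conclusion\<close>

lemma escapes_compacta_dist:
  fixes \<phi> :: "'g \<Rightarrow> 'x::metric_space \<Rightarrow> 'x"
  assumes X: "proper_metric_space TYPE('x)" and iso: "isometric_action G \<phi>"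
    and gs: "\<And>n. gs n \<in> carrier G" and esc: "escapes_compacta \<phi> gs"
  shows "filterlim (\<lambda>n. dist (\<phi> (gs n) x0) x0) at_top sequentially"
proof (subst filterlim_at_top, intro allI)
  fix Z :: real
  obtain x where x: "\<And>C. compact C \<Longrightarrow> \<forall>\<^sub>F n in sequentially. \<phi> (gs n) x \<notin> C"
    using esc by (auto simp: escapes_compacta_def)
  \<comment> \<open>The radius is enlarged by \<open>dist x x0\<close>, which is the constant
    distance between the translates of the given point \<open>x\<close> and of
    \<open>x0\<close>.\<close>
  have "compact (cball x0 (Z + dist x x0))" using X by (simp add: proper_metric_space_def)
  from x[OF this] show "\<forall>\<^sub>F n in sequentially. Z \<le> dist (\<phi> (gs n) x0) x0"
  proof eventually_elim
    case (elim n)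
    have "dist (\<phi> (gs n) x) (\<phi> (gs n) x0) = dist x x0"
      using iso gs by (simp add: isometric_action_def isometry_of_def)
    then show ?case using elim dist_triangle[of "\<phi> (gs n) x" x0 "\<phi> (gs n) x0"] by (simp add: dist_commute)
  qed
qed

text \<open>By properness only finitely many elements move a ball so that it meets itself, and a
  nonprincipal ultrafilter avoids every finite set.\<close>

lemma nonprincipal_ultrafilter_dist:
  fixes \<phi> :: "'g \<Rightarrow> 'x::metric_space \<Rightarrow> 'x"
  assumes X: "proper_metric_space TYPE('x)" and proper: "proper_action G \<phi>"
    and \<omega>: "nonprincipal_ultrafilter_on (carrier G) \<omega>"
  shows "filterlim (\<lambda>g. dist (\<phi> g x0) x0) at_top \<omega>"
proof (subst filterlim_at_top, intro allI)
  fix Z :: real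
  \<comment> \<open>The absolute value keeps \<open>x0\<close> in the ball when \<open>Z\<close> is
    negative.\<close>
  define A where "A = {g \<in> carrier G. \<phi> g ` cball x0 \<bar>Z\<bar> \<inter> cball x0 \<bar>Z\<bar> \<noteq> {}}"
  have "finite A" using X proper unfolding A_def proper_action_def proper_metric_space_def by blast
  moreover have "\<forall>\<^sub>F g in \<omega>. g \<noteq> a" for a using \<omega> unfolding nonprincipal_ultrafilter_on_def by metis
  ultimately have "\<forall>\<^sub>F g in \<omega>. \<forall>a\<in>A. g \<noteq> a" by (simp add: eventually_ball_finite)
  moreover have "\<forall>\<^sub>F g in \<omega>. g \<in> carrier G" using \<omega> by (simp add: nonprincipal_ultrafilter_on_def)
  ultimately show "\<forall>\<^sub>F g in \<omega>. Z \<le> dist (\<phi> g x0) x0"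
  proof eventually_elim
    case (elim g)
    have "\<phi> g x0 \<in> \<phi> g ` cball x0 \<bar>Z\<bar>" by simp
    moreover have "g \<notin> A" using elim by blast
    ultimately have "\<phi> g x0 \<notin> cball x0 \<bar>Z\<bar>" using elim unfolding A_def by blast
    then show ?case by (simp add: dist_commute)
  qed
qed

theorem theorem2p1:
  fixes G :: "('g, 'b) monoid_scheme"
    and \<phi> :: "'g \<Rightarrow> 'x::metric_space \<Rightarrow> 'x"
  assumes "group G"
    and "countable (carrier G)"
    and "proper_metric_space TYPE('x)"
    and "CAT0_space TYPE('x)"
    and "isometric_action G \<phi>"
    and "nonelementary_action G \<phi>"
    and "\<exists>g\<in>carrier G. rank_one_isometry (\<phi> g)"
  shows "properly_proximal_action G \<phi> \<and> (proper_action G \<phi> \<longrightarrow> properly_proximal_group G)"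
proof -
  obtain D :: "nat \<Rightarrow> 'x" where D: "\<And>y e. e > 0 \<Longrightarrow> \<exists>n. dist (D n) y < e"
    using proper_metric_space_dense_sequence[OF assms(3)] by blast
  obtain code :: "(nat \<Rightarrow> real) \<times> real \<Rightarrow> real" where code: "inj code"
    using ex_inj_real_sequences by blast
  define x0 :: 'x where "x0 = undefined"
  interpret coded_isometric_action G \<phi> x0 D code
    by (rule coded_isometric_action.intro[OF assms(1,5) D code])
  obtain k where "k \<in> carrier G" "rank_one_isometry (\<phi> k)" using assms(7) by blast
  note no_inv = no_invariant_probability_K[OF assms(4,3,6) this]
  have "properly_proximal_action G \<phi>"
    unfolding properly_proximal_action_def
  proof (rule exI[of _ 1], rule exI[of _ "\<lambda>_. K"], rule exI[of _ "\<lambda>_. \<alpha>"], rule exI[of _ "\<lambda>_. \<eta>"],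
      intro conjI allI impI)
    fix gs :: "nat \<Rightarrow> 'g" assume gs: "(\<forall>n. gs n \<in> carrier G) \<and> escapes_compacta \<phi> gs"
    have "filterlim (\<lambda>n. dist (\<phi> (gs n) x0) x0) at_top sequentially"
      using gs by (intro escapes_compacta_dist[OF assms(3,5)]) auto
    then have weak: "weak_star_diff_to_zero K
        (\<lambda>n. push K \<alpha> (gs n \<otimes>\<^bsub>G\<^esub> h) \<eta>) (\<lambda>n. push K \<alpha> (gs n) \<eta>) sequentially" if "h \<in> carrier G" for h
      using gs that by (intro weak_star_diff_push_\<eta>[OF assms(4)]) auto
    show "\<exists>i<1::nat. \<exists>\<sigma>. strict_mono \<sigma> \<and> (\<forall>h\<in>carrier G. weak_star_diff_to_zero K
        (\<lambda>n. push K \<alpha> (gs (\<sigma> n) \<otimes>\<^bsub>G\<^esub> h) \<eta>) (\<lambda>n. push K \<alpha> (gs (\<sigma> n)) \<eta>) sequentially)"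
      \<comment> \<open>The whole sequence already converges, so the identity serves as the
        subsequence.\<close>
      by (intro exI[of _ "0::nat"] exI[of _ id] conjI ballI) (simp_all add: strict_mono_def weak)
  qed (use compact_K metrizable_K G_space_K no_inv borel_probability_\<eta> diffuse_\<eta> in simp_all)
  moreover have "properly_proximal_group G" if proper: "proper_action G \<phi>"
    unfolding properly_proximal_group_def
  proof (rule exI[of _ 1], rule exI[of _ "\<lambda>_. K"], rule exI[of _ "\<lambda>_. \<alpha>"], rule exI[of _ "\<lambda>_. \<eta>"],
      intro conjI allI impI)
    fix \<omega> assume \<omega>: "nonprincipal_ultrafilter_on (carrier G) \<omega>"
    have "\<forall>\<^sub>F g in \<omega>. g \<in> carrier G" using \<omega> by (simp add: nonprincipal_ultrafilter_on_def)
    then have weak: "\<forall>h\<in>carrier G. weak_star_diff_to_zero K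
        (\<lambda>g. push K \<alpha> (g \<otimes>\<^bsub>G\<^esub> h) \<eta>) (\<lambda>g. push K \<alpha> g \<eta>) \<omega>"
      using weak_star_diff_push_\<eta>[OF assms(4) _ nonprincipal_ultrafilter_dist[OF assms(3) proper \<omega>]] by blast
    show "\<exists>i<1::nat. \<forall>h\<in>carrier G. weak_star_diff_to_zero K
        (\<lambda>g. push K \<alpha> (g \<otimes>\<^bsub>G\<^esub> h) \<eta>) (\<lambda>g. push K \<alpha> g \<eta>) \<omega>"
      by (intro exI[of _ "0::nat"] conjI weak) simp
  qed (use compact_K metrizable_imp_Hausdorff_space[OF metrizable_K] G_space_K no_inv borel_probability_\<eta> diffuse_\<eta> in simp_all)
  ultimately show ?thesis by blast
qed

end
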